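(* Let $x$ be a Sturmian word. Then for each infinite sequence $\omega=(G_n)_{n\geq 1}$, where each $G_n$ is an Abelian subgroup of the symmetric group $S_n$, there exists an infinite sequence $\omega'=(G'_n)_{n\geq 1}$, where for each $n\geq 1$ the group $G'_n$ is an (Abelian) subgroup of $S_n$ isomorphic to $G_n$ as an abstract group, such that for each $n\geq 1$ we have $p_{\omega',x}(n)=\epsilon(G'_n)+1$.
   Context: $S_n$ is the group of all bijections of $\{1,2,\ldots,n\}$. For a subgroup $G\subseteq S_n$, $\epsilon(G)$ denotes the number of distinct orbits of $G$ acting on $\{1,2,\ldots,n\}$ by $g*i=g(i)$. For a finite non-empty set $\mathbb{A}$, $\mathbb{A}^n$ is the set of words $u=u_1u_2\cdots u_n$ with $u_i\in\mathbb{A}$. $G$ acts on $\mathbb{A}^n$ by $g*u=u_{g^{-1}(1)}u_{g^{-1}(2)}\cdots u_{g^{-1}(n)}$. For an infinite word $x=x_0x_1x_2\cdots\in\mathbb{A}^{\mathbb{N}}$, $\mathrm{Fact}_x(n)=\{x_ix_{i+1}\cdots x_{i+n-1}\mid i\geq 0\}$ is the set of factors of $x$ of length $n$. For $u,v\in \mathrm{Fact}_x(n)$, write $u\sim_G v$ if $g*u=v$ for some $g\in G$. For a sequence $\omega=(G_n)_{n\geq1}$ of subgroups $G_n\subseteq S_n$, $p_{\omega,x}(n)=\mathrm{Card}(\mathrm{Fact}_x(n)/\sim_{G_n})$ is the number of $\sim_{G_n}$-equivalence classes of factors of $x$ of length $n$. An infinite word is aperiodic if it is not ultimately periodic. It is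 binary if exactly two distinct letters occur in it. It is balanced if for every pair of factors $u,v$ of $x$ of equal length and every letter $a$ we have $\big||u|_a-|v|_a\big|\leq 1$, where $|u|_a$ is the number of occurrences of $a$ in $u$. An infinite word is Sturmian if it is aperiodic, binary and balanced (equivalently, it has exactly $n+1$ distinct factors of each length $n$). *)

theory Defs
  imports "HOL-Algebra.Sym_Groups" "HOL-Algebra.Group_Action"
begin

text \<open>Infinite words over an alphabet are functions on \<^typ>\<open>nat\<close>; finite words are lists.\<close>

definition ultimately_periodic :: "(nat \<Rightarrow> 'a) \<Rightarrow> bool" where
  "ultimately_periodic x \<longleftrightarrow> (\<exists>N p. p > 0 \<and> (\<forall>i\<ge>N. x (i + p) = x i))"

definition aperiodic :: "(nat \<Rightarrow> 'a) \<Rightarrow> bool" where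
  "aperiodic x \<longleftrightarrow> \<not> ultimately_periodic x"

definition binary_word :: "(nat \<Rightarrow> 'a) \<Rightarrow> bool" where
  "binary_word x \<longleftrightarrow> card (range x) = 2"

definition Fact :: "(nat \<Rightarrow> 'a) \<Rightarrow> nat \<Rightarrow> 'a list set" where
  "Fact x n = {map x [i..<i + n] | i. True}"

definition balanced :: "(nat \<Rightarrow> 'a) \<Rightarrow> bool" where
  "balanced x \<longleftrightarrow> (\<forall>n. \<forall>u\<in>Fact x n. \<forall>v\<in>Fact x n. \<forall>a.
     \<bar>int (count_list u a) - int (count_list v a)\<bar> \<le> 1)"

definition sturmian :: "(nat \<Rightarrow> 'a) \<Rightarrow> bool" where
  "sturmian x \<longleftrightarrow> aperiodic x \<and> binary_word x \<and> balanced x"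

text \<open>A subset \<open>H\<close> of the carrier of \<open>sym_group n\<close> viewed as a structure of its own.\<close>

abbreviation sym_subgroup :: "nat \<Rightarrow> (nat \<Rightarrow> nat) set \<Rightarrow> (nat \<Rightarrow> nat) monoid" where
  "sym_subgroup n H \<equiv> (sym_group n)\<lparr>carrier := H\<rparr>"

definition num_orbits :: "nat \<Rightarrow> (nat \<Rightarrow> nat) set \<Rightarrow> nat" where
  "num_orbits n H = card (orbits (sym_subgroup n H) {1..n} (\<lambda>g i. g i))"

text \<open>The permutations act on positions \<open>1, \<dots>, n\<close>, whereas list indices start at \<open>0\<close>:
  the letter of \<open>u\<close> at position \<open>j\<close> is \<open>u ! (j - 1)\<close>.\<close>

definition word_act :: "(nat \<Rightarrow> nat) \<Rightarrow> 'a list \<Rightarrow> 'a list" where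
  "word_act g u = map (\<lambda>i. u ! (inv' g i - 1)) [1..<Suc (length u)]"

definition fact_rel :: "(nat \<Rightarrow> nat) set \<Rightarrow> (nat \<Rightarrow> 'a) \<Rightarrow> nat \<Rightarrow> 'a list rel" where
  "fact_rel H x n = {(u, v). u \<in> Fact x n \<and> v \<in> Fact x n \<and> (\<exists>g\<in>H. word_act g u = v)}"

definition group_complexity :: "(nat \<Rightarrow> (nat \<Rightarrow> nat) set) \<Rightarrow> (nat \<Rightarrow> 'a) \<Rightarrow> nat \<Rightarrow> nat" where
  "group_complexity \<omega> x n = card (Fact x n // fact_rel (\<omega> n) x n)"

end

theory Submission
  imports Defs Complex_Main "HOL-Computational_Algebra.Primes" "HOL-Algebra.Multiplicative_Group"
begin

text \<open>
  The group \<open>G'\<^sub>n\<close> permutes the positions within consecutive blocks. Let \<open>r\<^sub>1, \<dots>, r\<^sub>l\<close> be positive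
  integers with sum \<open>n\<close>, cut \<open>{1..n}\<close> into blocks of these lengths, choose in the \<open>i\<close>-th block a cycle
  through all of its \<open>r\<^sub>i\<close> positions, and let \<open>G'\<^sub>n\<close> be generated by these cycles. This group is the direct
  product of cyclic groups of orders \<open>r\<^sub>1, \<dots>, r\<^sub>l\<close>, and its orbits are the \<open>l\<close> blocks. It remains to
  reach the isomorphism type of \<open>G\<^sub>n\<close> in this way and to choose the cycles so that there are \<open>l + 1\<close>
  classes of factors.

  For the isomorphism type, an abelian group acting faithfully on \<open>n\<close> points has to be a direct product
  of cyclic groups whose orders sum to at most \<open>n\<close> (lemma \<open>faithful_action_cyclic_basis\<close>); trivial
  factors fill up the sum. A cyclic subgroup of maximal \<open>p\<close>-power order that meets the stabilizer of
  some point trivially is a direct factor, with a complement that contains this stabilizer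
  (\<open>cyclic_p_subgroup_complement\<close>), and the orbit of that point pays for the factor split off.

  For the cycles, the factors of length \<open>m\<close> of a Sturmian word come from lines of one common slope
  \<open>\<alpha>\<close>. If position \<open>j\<close> is placed at the point \<open>frac (j \<alpha>)\<close> of a circle, the occurrences of a letter
  in a factor fill an arc (\<open>factor_is_cyclic_interval\<close>). So for the cycle that follows the circular
  order of the positions, two factors with equally many occurrences of the letter differ by a power of
  the cycle (\<open>equal_occ_factors_rotated\<close>). Since the blocks of a factor are again factors and are
  rotated independently, two factors of length \<open>n\<close> are equivalent if and only if corresponding blocks
  contain the letter equally often (\<open>block_rotation_between_factors_iff\<close>).

  To count the classes, replace the counts in the blocks by the counts in the \<open>l\<close> prefixes that end
  with a block. Each of these takes two values, a low and a high one. By balance, the sets of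
  prefixes with high count form a chain, and by aperiodicity this chain separates the \<open>l\<close> prefixes from
  each other. Such a chain has exactly \<open>l + 1\<close> members (\<open>card_separating_chain\<close>).
\<close>

section \<open>Complements of cyclic subgroups in finite abelian groups\<close>

lemma (in group) subgroup_int_pow_mem:
  assumes "subgroup H G" "h \<in> H"
  shows "h [^] (i::int) \<in> H"
proof -
  interpret S: group "G\<lparr>carrier := H\<rparr>"
    using assms(1) subgroup_imp_group by blast
  have "h [^]\<^bsub>G\<lparr>carrier := H\<rparr>\<^esub> i \<in> H"
    using S.int_pow_closed[of h i] assms(2) by simp
  then show ?thesis
    using int_pow_consistent[OF assms] by simp
qed

lemma (in group) mem_subgroup_if_coprime_powers:
  assumes M: "subgroup M G" and y: "y \<in> carrier G"
    and "y [^] (i::int) \<in> M" "y [^] (j::int) \<in> M" and "coprime i j"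
  shows "y \<in> M"
proof -
  obtain u v where uv: "i * u + j * v = 1"
    using bezout_int[of i j] \<open>coprime i j\<close> by (metis coprime_iff_gcd_eq_1 mult.commute)
  have "y [^] (i * u) \<in> M" "y [^] (j * v) \<in> M"
    using assms(3,4) subgroup_int_pow_mem[OF M] int_pow_pow[OF y] by metis+
  then have "y [^] (i * u + j * v) \<in> M"
    by (simp add: int_pow_mult y subgroup.m_closed[OF M])
  then show ?thesis using uv y by simp
qed

text \<open>The least positive exponent that takes \<open>x\<close> into \<open>M\<close> is not \<open>1\<close>; any prime divisor \<open>q\<close>
  of it will do. This yields elements outside \<open>M\<close> whose \<open>q\<close>-th power lies in \<open>M\<close>, without
  passing to a quotient group.\<close>

lemma (in group) prime_power_entering_subgroup:
  assumes M: "subgroup M G" and x: "x \<in> carrier G" "x \<notin> M"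
    and n: "x [^] (n::nat) \<in> M" "n > 0"
  obtains q k :: nat where "prime q" "x [^] k \<notin> M" "x [^] (k * q) \<in> M"
proof -
  define m where "m = (LEAST m::nat. m > 0 \<and> x [^] m \<in> M)"
  have m: "m > 0" "x [^] m \<in> M"
    using LeastI[of "\<lambda>m. m > 0 \<and> x [^] m \<in> M" n] n by (auto simp: m_def)
  have least: "m \<le> r" if "r > 0" "x [^] r \<in> M" for r
    unfolding m_def using that by (auto intro: Least_le)
  have "m \<noteq> 1" using m x by (metis nat_pow_eone)
  then obtain q where q: "prime q" "q dvd m" using prime_factor_nat by blast
  then obtain k where k: "m = k * q" by (metis dvd_div_mult_self)
  have "k > 0" "k < m" using m k prime_gt_1_nat[OF q(1)] by (auto simp: k)
  then have "x [^] k \<notin> M" using least[of k] by auto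
  then show ?thesis using that q m k by metis
qed

lemma (in comm_group) subgroup_adjoin_powers:
  assumes L: "subgroup L G" and y: "y \<in> carrier G"
  shows "subgroup {y [^] i \<otimes> l | (i::int) l. l \<in> L} G"
proof -
  have Lc: "L \<subseteq> carrier G" using L subgroup.subset by blast
  show ?thesis
  proof (rule subgroupI)
    show "{y [^] i \<otimes> l | (i::int) l. l \<in> L} \<subseteq> carrier G" using Lc y by auto
    show "{y [^] i \<otimes> l | (i::int) l. l \<in> L} \<noteq> {}" using subgroup.one_closed[OF L] by blast
  next
    fix a assume "a \<in> {y [^] i \<otimes> l | (i::int) l. l \<in> L}"
    then obtain i :: int and l where a: "a = y [^] i \<otimes> l" "l \<in> L" by blast
    have "inv a = y [^] (-i) \<otimes> inv l"
      using a Lc y by (simp add: inv_mult int_pow_neg subset_iff)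
    then show "inv a \<in> {y [^] i \<otimes> l | (i::int) l. l \<in> L}"
      using subgroup.m_inv_closed[OF L a(2)] by blast
  next
    fix a b assume "a \<in> {y [^] i \<otimes> l | (i::int) l. l \<in> L}" "b \<in> {y [^] i \<otimes> l | (i::int) l. l \<in> L}"
    then obtain i j :: int and l k where a: "a = y [^] i \<otimes> l" "l \<in> L" and b: "b = y [^] j \<otimes> k" "k \<in> L"
      by blast
    have "a \<otimes> b = y [^] (i + j) \<otimes> (l \<otimes> k)"
      using a b Lc y by (simp add: int_pow_mult subset_iff m_ac)
    then show "a \<otimes> b \<in> {y [^] i \<otimes> l | (i::int) l. l \<in> L}"
      using subgroup.m_closed[OF L a(2) b(2)] by blast
  qed
qed

lemma (in group) subset_adjoin_powers:
  assumes L: "subgroup L G" and y: "y \<in> carrier G"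
  shows "L \<subseteq> {y [^] i \<otimes> l | (i::int) l. l \<in> L}"
proof
  fix l assume l: "l \<in> L"
  then have "l = y [^] (0::int) \<otimes> l" using subgroup.subset[OF L] by auto
  then show "l \<in> {y [^] i \<otimes> l | (i::int) l. l \<in> L}" using l by blast
qed

text \<open>A cyclic \<open>p\<close>-subgroup of largest possible order is a direct factor of a finite abelian
  group, and the complement can be chosen above any prescribed subgroup \<open>H\<close> that meets it
  trivially. The complement is a maximal element \<open>L\<close> among the subgroups above \<open>H\<close> that meet
  \<open>\<langle>g\<rangle>\<close> trivially. If \<open>\<langle>g\<rangle> L\<close> were not everything, some \<open>x\<close> outside it would satisfy
  \<open>x\<^sup>q = g\<^sup>t l\<close> with \<open>q\<close> prime. Since \<open>q\<close> divides \<open>t\<close> modulo the order of \<open>g\<close>, correcting \<open>x\<close> by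
  a power of \<open>g\<close> gives \<open>y\<close> outside \<open>\<langle>g\<rangle> L\<close> with \<open>y\<^sup>q \<in> L\<close>, and then \<open>\<langle>y\<rangle> L\<close> still meets \<open>\<langle>g\<rangle>\<close>
  trivially, against maximality.\<close>

lemma (in comm_group) cyclic_p_subgroup_complement:
  assumes fin: "finite (carrier G)" and K: "subgroup K G" and g: "g \<in> K"
    and p: "prime (p::nat)" and ordg: "ord g = p ^ a"
    and max: "\<forall>h\<in>K. \<forall>b. ord h = p ^ b \<longrightarrow> b \<le> a"
    and H: "subgroup H G" "H \<subseteq> K" and Hg: "\<forall>i::int. g [^] i \<in> H \<longrightarrow> g [^] i = \<one>"
  obtains L where "subgroup L G" "H \<subseteq> L" "L \<subseteq> K" "\<And>i::int. g [^] i \<in> L \<Longrightarrow> g [^] i = \<one>"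
    "K = {g [^] i \<otimes> l | (i::int) l. l \<in> L}"
proof -
  have Kc: "K \<subseteq> carrier G" using K subgroup.subset by blast
  then have gc: "g \<in> carrier G" using g by blast
  define A where "A = {L. subgroup L G \<and> H \<subseteq> L \<and> L \<subseteq> K \<and> (\<forall>i::int. g [^] i \<in> L \<longrightarrow> g [^] i = \<one>)}"
  have "finite A" "H \<in> A"
    using finite_subset[OF Kc fin] H Hg by (auto simp: A_def)
  then obtain L where L: "L \<in> A" and maxL: "\<And>L'. L' \<in> A \<Longrightarrow> L \<subseteq> L' \<Longrightarrow> L' = L"
    using finite_has_maximal2[of A H] by metis
  have Ls: "subgroup L G" and HL: "H \<subseteq> L" and LK: "L \<subseteq> K"
    and Lg: "\<And>i::int. g [^] i \<in> L \<Longrightarrow> g [^] i = \<one>" using L by (auto simp: A_def)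
  define M where "M = {g [^] i \<otimes> l | (i::int) l. l \<in> L}"
  have Lc: "L \<subseteq> carrier G" using LK Kc by blast
  have M: "subgroup M G" unfolding M_def using subgroup_adjoin_powers[OF Ls gc] .
  have LM: "L \<subseteq> M"
    unfolding M_def by (rule subset_adjoin_powers[OF Ls gc])
  have gM: "g [^] (i::int) \<in> M" for i
    using subgroup.one_closed[OF Ls] gc unfolding M_def by force
  have MK: "M \<subseteq> K"
    using subgroup_int_pow_mem[OF K g] LK subgroup.m_closed[OF K] by (auto simp: M_def)
  have "K \<subseteq> M"
  proof (rule ccontr)
    assume "\<not> K \<subseteq> M"
    then obtain x0 where x0: "x0 \<in> K" "x0 \<notin> M" by blast
    have x0c: "x0 \<in> carrier G" using x0 Kc by blast
    have "x0 [^] ord x0 \<in> M" "ord x0 > 0"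
      using pow_ord_eq_1[OF x0c] subgroup.one_closed[OF M] ord_ge_1[OF fin x0c] by auto
    then obtain q k :: nat where q: "prime q" and k: "x0 [^] k \<notin> M" "x0 [^] (k * q) \<in> M"
      using prime_power_entering_subgroup[OF M x0c x0(2)] by metis
    define x where "x = x0 [^] k"
    have xK: "x \<in> K" unfolding x_def using subgroup_int_pow_mem[OF K x0(1), of "int k"]
      by (simp add: int_pow_int)
    have xc: "x \<in> carrier G" using xK Kc by blast
    have xM: "x \<notin> M" using k x_def by simp
    have "x [^] (int q) \<in> M"
      using k(2) x0c by (simp add: x_def int_pow_int nat_pow_pow)
    then obtain t :: int and l where tl: "x [^] (int q) = g [^] t \<otimes> l" and l: "l \<in> L"
      unfolding M_def by blast
    have lc: "l \<in> carrier G" using l Lc by blast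
    \<comment> \<open>For \<open>q \<noteq> p\<close> the prime \<open>q\<close> is invertible modulo \<open>p\<^sup>a\<close>. For \<open>q = p\<close> the maximality of \<open>p\<^sup>a\<close>
      bounds the \<open>p\<close>-part of the order of \<open>x\<close>, which forces \<open>p\<close> to divide \<open>t\<close>.\<close>
    have "\<exists>s::int. int (p ^ a) dvd t - s * int q"
    proof (cases "q = p")
      case False
      then have "coprime (int q) (int (p ^ a))"
        using p q by (simp add: primes_coprime coprime_commute)
      then obtain u v where "int q * u + int (p ^ a) * v = 1"
        using bezout_int[of "int q" "int (p ^ a)"]
        by (metis coprime_iff_gcd_eq_1 mult.commute)
      then have "t = t * (int q * u + int (p ^ a) * v)" by simp
      then have "t - (t * u) * int q = int (p ^ a) * (v * t)" by (simp add: algebra_simps)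
      then show ?thesis by (metis dvd_triv_left)
    next
      case True
      have "ord x > 0" using ord_ge_1[OF fin xc] by simp
      then obtain b m where bm: "ord x = p ^ b * m" "\<not> p dvd m"
        using multiplicity_decompose'[of "ord x" p] p by (metis not_prime_unit gr_implies_not0)
      have "m > 0" using bm(2) by (cases m) auto
      have "ord (x [^] m) = p ^ b"
        using ord_pow[OF xc, of m] bm \<open>m > 0\<close> by auto
      moreover have "x [^] m \<in> K"
        using subgroup_int_pow_mem[OF K xK, of "int m"] by (simp add: int_pow_int)
      ultimately have ba: "b \<le> a" using max by blast
      show ?thesis
      proof (cases a)
        case 0
        then show ?thesis by simp
      next
        case (Suc a')
        have "p ^ b * m dvd p ^ a * m" using ba by (simp add: le_imp_power_dvd mult_dvd_mono)
        then have "x [^] (int (p ^ a * m)) = \<one>"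
          using bm int_pow_eq_id[OF xc] by (metis of_nat_dvd_iff)
        moreover have "int (p ^ a * m) = int q * int (p ^ a' * m)" using Suc True by simp
        ultimately have "(g [^] t \<otimes> l) [^] int (p ^ a' * m) = \<one>"
          using int_pow_pow[OF xc] tl by metis
        then have "g [^] (t * int (p ^ a' * m)) \<otimes> l [^] int (p ^ a' * m) = \<one>"
          using gc lc by (simp add: int_pow_distrib int_pow_pow)
        then have "g [^] (t * int (p ^ a' * m)) = inv (l [^] int (p ^ a' * m))"
          using gc lc inv_equality[of "g [^] (t * int (p ^ a' * m))" "l [^] int (p ^ a' * m)"] by simp
        also have "\<dots> \<in> L"
          using subgroup.m_inv_closed[OF Ls subgroup_int_pow_mem[OF Ls l]] .
        finally have "g [^] (t * int (p ^ a' * m)) = \<one>" using Lg by blast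
        then have "int (p ^ a) dvd t * int (p ^ a' * m)"
          using int_pow_eq_id[OF gc] ordg by simp
        then have "int (p ^ a') * int p dvd int (p ^ a') * (t * int m)"
          using Suc by (simp add: mult.commute mult.left_commute)
        then have "int p dvd t * int m"
          using p by (simp add: prime_gt_0_nat)
        then have "int p dvd t"
          using bm(2) p by (metis int_dvd_int_iff prime_dvd_mult_iff prime_nat_int_transfer)
        then obtain s where "t = int p * s" by blast
        then show ?thesis using True by (intro exI[of _ s]) (simp add: mult.commute)
      qed
    qed
    then obtain s :: int where s: "int (p ^ a) dvd t - s * int q" by blast
    define y where "y = x \<otimes> g [^] (- s)"
    have yc: "y \<in> carrier G" using xc gc by (simp add: y_def)
    have yK: "y \<in> K"
      unfolding y_def using xK subgroup_int_pow_mem[OF K g] subgroup.m_closed[OF K] by blast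
    have yM: "y \<notin> M"
    proof
      assume "y \<in> M"
      then have "y \<otimes> g [^] s \<in> M" using gM subgroup.m_closed[OF M] by blast
      moreover have "y \<otimes> g [^] s = x"
        using xc gc by (simp add: y_def m_assoc flip: int_pow_mult)
      ultimately show False using xM by simp
    qed
    have "y [^] (int q) = x [^] (int q) \<otimes> g [^] (- s * int q)"
      using xc gc by (simp add: y_def int_pow_distrib int_pow_pow)
    also have "\<dots> = g [^] (t - s * int q) \<otimes> l"
      using tl gc lc by (simp add: int_pow_diff int_pow_neg m_ac)
    also have "\<dots> = l" using s gc lc ordg int_pow_eq_id[OF gc] by simp
    finally have yq: "y [^] (int q) = l" .
    define L' where "L' = {y [^] i \<otimes> l | (i::int) l. l \<in> L}"
    have LL': "L \<subseteq> L'"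
      unfolding L'_def by (rule subset_adjoin_powers[OF Ls yc])
    have "L' \<in> A"
      unfolding A_def
    proof (intro CollectI conjI allI impI)
      show "subgroup L' G" unfolding L'_def using subgroup_adjoin_powers[OF Ls yc] .
      show "L' \<subseteq> K" using subgroup_int_pow_mem[OF K yK] LK subgroup.m_closed[OF K]
        by (auto simp: L'_def)
      show "H \<subseteq> L'" using HL LL' by blast
      fix j :: int
      assume "g [^] j \<in> L'"
      then obtain i :: int and k where ik: "g [^] j = y [^] i \<otimes> k" and k: "k \<in> L"
        unfolding L'_def by blast
      have kc: "k \<in> carrier G" using k Lc by blast
      have yi: "y [^] i = g [^] j \<otimes> inv k"
        using ik kc yc gc by (simp add: m_assoc)
      have ik': "inv k \<in> L" using subgroup.m_inv_closed[OF Ls k] .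
      have "y [^] i \<in> M" unfolding yi M_def using ik' by blast
      have "int q dvd i"
      proof (rule ccontr)
        assume "\<not> int q dvd i"
        then have "coprime i (int q)"
          using q by (metis coprime_commute prime_imp_coprime prime_nat_int_transfer)
        then show False
          using mem_subgroup_if_coprime_powers[OF M yc \<open>y [^] i \<in> M\<close>] yq l LM yM by blast
      qed
      then obtain r where "i = int q * r" by blast
      then have "y [^] i \<in> L"
        using yq l int_pow_pow[OF yc] subgroup_int_pow_mem[OF Ls l] by metis
      then have "g [^] j \<in> L" using ik k subgroup.m_closed[OF Ls] by metis
      then show "g [^] j = \<one>" using Lg by blast
    qed
    then have "L' = L" using maxL LL' by blast
    moreover have "y = y [^] (1::int) \<otimes> \<one>" using yc by simp
    then have "y \<in> L'" unfolding L'_def using subgroup.one_closed[OF Ls] by blast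
    ultimately show False using yM LM by blast
  qed
  then have "K = M" using MK by blast
  then show ?thesis using that Ls HL LK Lg M_def by blast
qed

section \<open>Cyclic bases of abelian groups acting faithfully\<close>

primrec power_product :: "('a, 'b) monoid_scheme \<Rightarrow> 'a list \<Rightarrow> (nat \<Rightarrow> int) \<Rightarrow> 'a" where
  "power_product G [] e = \<one>\<^bsub>G\<^esub>"
| "power_product G (g # gs) e = g [^]\<^bsub>G\<^esub> e 0 \<otimes>\<^bsub>G\<^esub> power_product G gs (\<lambda>i. e (Suc i))"

lemma (in comm_group) power_product_closed:
  "set gs \<subseteq> carrier G \<Longrightarrow> power_product G gs e \<in> carrier G"
  by (induction gs arbitrary: e) auto

lemma (in comm_group) power_product_add:
  "set gs \<subseteq> carrier G \<Longrightarrow>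
    power_product G gs (\<lambda>i. e i + f i) = power_product G gs e \<otimes> power_product G gs f"
  by (induction gs arbitrary: e f) (auto simp: int_pow_mult m_ac power_product_closed)

text \<open>The family \<open>gs\<close> presents \<open>K\<close> as the internal direct product of the cyclic groups generated by
  its members. Members equal to the identity are allowed, so that the sum of the orders can be
  raised freely.\<close>

definition (in comm_group) cyclic_basis :: "'a list \<Rightarrow> 'a set \<Rightarrow> bool" where
  "cyclic_basis gs K \<longleftrightarrow> set gs \<subseteq> K \<and> range (power_product G gs) = K \<and>
    (\<forall>e. power_product G gs e = \<one> \<longrightarrow> (\<forall>i<length gs. int (ord (gs ! i)) dvd e i))"

lemma (in comm_group) power_product_eq_one:
  assumes "set gs \<subseteq> carrier G" "\<And>i. i < length gs \<Longrightarrow> int (ord (gs ! i)) dvd e i"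
  shows "power_product G gs e = \<one>"
  using assms
proof (induction gs arbitrary: e)
  case (Cons g gs)
  have "int (ord g) dvd e 0" using Cons.prems(2)[of 0] by simp
  moreover have "power_product G gs (\<lambda>i. e (Suc i)) = \<one>"
    using Cons.prems(1) Cons.prems(2)[of "Suc _"] by (intro Cons.IH) auto
  ultimately show ?case using Cons.prems(1) int_pow_eq_id by simp
qed simp

lemma (in comm_group) power_product_eq_iff:
  assumes "cyclic_basis gs K" "K \<subseteq> carrier G"
  shows "power_product G gs e = power_product G gs f \<longleftrightarrow>
    (\<forall>i<length gs. int (ord (gs ! i)) dvd e i - f i)"
proof -
  have gs: "set gs \<subseteq> carrier G" using assms by (auto simp: cyclic_basis_def)
  have "power_product G gs e = power_product G gs (\<lambda>i. e i - f i) \<otimes> power_product G gs f"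
    using power_product_add[OF gs, of "\<lambda>i. e i - f i" f] by simp
  then have "power_product G gs e = power_product G gs f \<longleftrightarrow> power_product G gs (\<lambda>i. e i - f i) = \<one>"
    using power_product_closed[OF gs] by (simp add: r_cancel_one)
  also have "\<dots> \<longleftrightarrow> (\<forall>i<length gs. int (ord (gs ! i)) dvd e i - f i)"
    using power_product_eq_one[OF gs, of "\<lambda>i. e i - f i"] assms(1)
    unfolding cyclic_basis_def by blast
  finally show ?thesis .
qed

lemma (in comm_group) cyclic_basis_Cons:
  assumes gs: "cyclic_basis gs L" and L: "subgroup L G" and g: "g \<in> carrier G"
    and gL: "\<And>i::int. g [^] i \<in> L \<Longrightarrow> g [^] i = \<one>"
  shows "cyclic_basis (g # gs) {g [^] i \<otimes> l | (i::int) l. l \<in> L}" (is "cyclic_basis _ ?K")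
proof -
  have Lc: "L \<subseteq> carrier G" using L subgroup.subset by blast
  have gs': "set gs \<subseteq> L" and ran: "range (power_product G gs) = L" using gs by (auto simp: cyclic_basis_def)
  have "g = g [^] (1::int) \<otimes> \<one>" using g by simp
  then have "g \<in> ?K" using subgroup.one_closed[OF L] by blast
  moreover have "L \<subseteq> ?K" by (rule subset_adjoin_powers[OF L g])
  moreover have "range (power_product G (g # gs)) = ?K"
  proof
    show "range (power_product G (g # gs)) \<subseteq> ?K" using ran by auto
    show "?K \<subseteq> range (power_product G (g # gs))"
    proof
      fix k assume "k \<in> ?K"
      then obtain i :: int and e where "k = g [^] i \<otimes> power_product G gs e" using ran by blast
      then have "k = power_product G (g # gs) (case_nat i e)" by simp
      then show "k \<in> range (power_product G (g # gs))" by blast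
    qed
  qed
  moreover have "int (ord ((g # gs) ! j)) dvd e j"
    if e: "power_product G (g # gs) e = \<one>" and j: "j < length (g # gs)" for e j
  proof -
    let ?r = "power_product G gs (\<lambda>i. e (Suc i))"
    have r: "?r \<in> L" using ran by blast
    have "g [^] e 0 \<otimes> ?r = \<one>" using e by simp
    then have "g [^] e 0 = inv ?r" using g r Lc by (metis inv_equality int_pow_closed inv_inv subsetD m_comm)
    then have "g [^] e 0 = \<one>" using gL r subgroup.m_inv_closed[OF L] by metis
    then have "int (ord g) dvd e 0" using int_pow_eq_id[OF g] by simp
    moreover have "?r = \<one>" using \<open>g [^] e 0 = \<one>\<close> e r Lc l_one[of ?r] by auto
    ultimately have "int (ord g) dvd e 0" "?r = \<one>" by simp_all
    then show ?thesis
      using gs j unfolding cyclic_basis_def by (cases j) auto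
  qed
  ultimately show ?thesis using gs' unfolding cyclic_basis_def by auto
qed

lemma add_le_mult_nat: "2 \<le> (a::nat) \<Longrightarrow> 2 \<le> b \<Longrightarrow> a + b \<le> a * b"
proof -
  assume "2 \<le> a" "2 \<le> b"
  then obtain c d where "a = c + 2" "b = d + 2" by (metis le_add_diff_inverse2)
  then show ?thesis by (simp add: algebra_simps)
qed

lemma (in group) max_p_power_order:
  assumes fin: "finite (carrier G)" and K: "subgroup K G" "K \<noteq> {\<one>}"
  obtains p a :: nat and g where "prime p" "g \<in> K" "ord g = p ^ Suc a"
    "\<forall>h\<in>K. \<forall>b. ord h = p ^ b \<longrightarrow> b \<le> Suc a"
proof -
  have Kc: "K \<subseteq> carrier G" using K subgroup.subset by blast
  obtain x where x: "x \<in> K" "x \<noteq> \<one>" using K subgroup.one_closed by blast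
  then have xc: "x \<in> carrier G" using Kc by blast
  have "ord x \<noteq> 1" using x ord_eq_1[OF xc] by simp
  then obtain p where p: "prime p" "p dvd ord x" using prime_factor_nat by blast
  then obtain d where d: "ord x = p * d" by blast
  have "ord x \<ge> 1" using ord_ge_1[OF fin xc] .
  then have "d \<noteq> 0" using d by (cases d) auto
  then have "ord (x [^] d) = p ^ 1" using ord_pow[OF xc, of d] d by simp
  moreover have "x [^] d \<in> K" using subgroup_int_pow_mem[OF K(1) x(1), of "int d"] by (simp add: int_pow_int)
  ultimately have ex: "\<exists>h\<in>K. ord h = p ^ 1" by blast
  have bd: "b \<le> order G" if b: "\<exists>h\<in>K. ord h = p ^ b" for b
  proof -
    obtain h where "h \<in> K" "ord h = p ^ b" using b by blast
    then have "p ^ b \<le> order G" using ord_le_group_order[OF fin, of h] Kc by auto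
    moreover have "b < p ^ b" using p prime_gt_1_nat by (simp add: power_gt_expt)
    ultimately show ?thesis by simp
  qed
  define a where "a = (GREATEST b. \<exists>h\<in>K. ord h = p ^ b)"
  have a: "\<exists>h\<in>K. ord h = p ^ a"
    unfolding a_def using GreatestI_nat[of "\<lambda>b. \<exists>h\<in>K. ord h = p ^ b" 1 "order G"] ex bd by blast
  have le: "b \<le> a" if "\<exists>h\<in>K. ord h = p ^ b" for b
    unfolding a_def using Greatest_le_nat[of "\<lambda>b. \<exists>h\<in>K. ord h = p ^ b" b "order G"] that bd by blast
  have "a \<ge> 1" using le[OF ex] .
  then obtain a' where "a = Suc a'" by (cases a) auto
  then show ?thesis using that p(1) a le by metis
qed

text \<open>The subgroups of a cyclic \<open>p\<close>-group form a chain, so every nontrivial one contains the subgroup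
  of order \<open>p\<close>, which is generated by \<open>g\<close> to the power \<open>p\<^sup>a\<close>.\<close>

lemma (in group) cyclic_p_subgroup_trivial_meet:
  assumes H: "subgroup H G" and g: "g \<in> carrier G" and p: "prime (p::nat)" and ordg: "ord g = p ^ Suc a"
    and z: "g [^] (int (p ^ a)) \<notin> H" and i: "g [^] (i::int) \<in> H"
  shows "g [^] i = \<one>"
proof (rule ccontr)
  assume "g [^] i \<noteq> \<one>"
  then have ndvd: "\<not> int (p ^ Suc a) dvd i" using int_pow_eq_id[OF g] ordg by simp
  have "gcd i (int (p ^ Suc a)) dvd int p ^ Suc a" by simp
  then obtain c where c: "c \<le> Suc a" "gcd i (int (p ^ Suc a)) = int p ^ c"
    using divides_primepow[of "int p" "gcd i (int (p ^ Suc a))" "Suc a"] p by auto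
  have "c \<noteq> Suc a"
  proof
    assume "c = Suc a"
    then have "int (p ^ Suc a) = gcd i (int (p ^ Suc a))" using c by simp
    then show False using ndvd by (metis gcd_dvd1)
  qed
  then have "int p ^ c dvd int (p ^ a)" using c by (simp add: le_imp_power_dvd)
  then obtain m where m: "int (p ^ a) = int p ^ c * m" by blast
  obtain u v where "u * i + v * int (p ^ Suc a) = int p ^ c"
    using bezout_int[of i "int (p ^ Suc a)"] c by metis
  then have e: "int (p ^ a) = i * (u * m) + int (p ^ Suc a) * (v * m)"
    using m by (metis (no_types, opaque_lifting) distrib_right mult.assoc mult.commute)
  have "g [^] (int (p ^ Suc a) * (v * m)) = \<one>"
    using int_pow_eq_id[OF g] ordg by simp
  then have "g [^] (int (p ^ a)) = g [^] (i * (u * m))"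
    unfolding e using g by (simp add: int_pow_mult)
  also have "\<dots> \<in> H" using subgroup_int_pow_mem[OF H i, of "u * m"] int_pow_pow[OF g] by simp
  finally show False using z by simp
qed

text \<open>An abelian group acting faithfully on \<open>N\<close> points is a direct product of cyclic groups whose
  orders sum to at most \<open>N\<close>. One factor \<open>\<langle>g\<rangle>\<close> is split off at a time. Take \<open>g\<close> of maximal
  \<open>p\<close>-power order and a point \<open>x0\<close> moved by the element of order \<open>p\<close> in \<open>\<langle>g\<rangle>\<close>; then \<open>\<langle>g\<rangle>\<close> meets
  the stabilizer of \<open>x0\<close> trivially and has a complement \<open>L\<close> above this stabilizer. The orbit of
  \<open>x0\<close> is at least \<open>ord g\<close> times as large as its orbit under \<open>L\<close>, and \<open>L\<close> remains faithful when
  the former is replaced by the latter, because in an abelian group an element fixing a point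
  fixes its whole orbit. The points removed pay for the order of \<open>g\<close>, because
  \<open>r + c \<le> r c\<close> for \<open>r, c \<ge> 2\<close>; if \<open>L\<close> fixes \<open>x0\<close>, the point itself is dropped as well.\<close>

lemma (in comm_group) faithful_action_cyclic_basis:
  fixes act :: "'a \<Rightarrow> 'c \<Rightarrow> 'c"
  assumes fin: "finite (carrier G)"
    and act_one: "\<And>x. act \<one> x = x"
    and act_mult: "\<And>g h x. g \<in> carrier G \<Longrightarrow> h \<in> carrier G \<Longrightarrow> act (g \<otimes> h) x = act g (act h x)"
    and "subgroup K G" "finite X"
    and "\<And>k x. k \<in> K \<Longrightarrow> x \<in> X \<Longrightarrow> act k x \<in> X"
    and "\<And>k. k \<in> K \<Longrightarrow> (\<And>x. x \<in> X \<Longrightarrow> act k x = x) \<Longrightarrow> k = \<one>"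
  shows "\<exists>gs. cyclic_basis gs K \<and> sum_list (map ord gs) \<le> card X"
  using assms(4-7)
proof (induction "card K" arbitrary: K X rule: less_induct)
  case less
  note K = less.prems(1) and finX = less.prems(2) and inv = less.prems(3) and faith = less.prems(4)
  have Kc: "K \<subseteq> carrier G" using K subgroup.subset by blast
  show ?case
  proof (cases "K = {\<one>}")
    case True
    then have "cyclic_basis [] K" by (auto simp: cyclic_basis_def)
    then show ?thesis by (intro exI[of _ "[]"]) auto
  next
    case False
    then obtain p a g where p: "prime (p::nat)" and gK: "g \<in> K" and ordg: "ord g = p ^ Suc a"
      and maxg: "\<forall>h\<in>K. \<forall>b. ord h = p ^ b \<longrightarrow> b \<le> Suc a"
      using max_p_power_order[OF fin K] by metis
    have gc: "g \<in> carrier G" using gK Kc by blast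
    have p2: "p \<ge> 2" using p prime_ge_2_nat by blast
    have "\<not> int (p ^ Suc a) dvd int (p ^ a)"
    proof
      assume "int (p ^ Suc a) dvd int (p ^ a)"
      then have "p ^ Suc a dvd p ^ a" by (simp only: int_dvd_int_iff)
      then have "p ^ Suc a \<le> p ^ a" using p2 by (intro dvd_imp_le) auto
      then show False using p2 by simp
    qed
    then have "g [^] (int (p ^ a)) \<noteq> \<one>" using int_pow_eq_id[OF gc] ordg by simp
    then have "\<not> (\<forall>x\<in>X. act (g [^] (int (p ^ a))) x = x)"
      using faith[OF subgroup_int_pow_mem[OF K gK]] by metis
    then obtain x0 where x0: "x0 \<in> X" "act (g [^] (int (p ^ a))) x0 \<noteq> x0" by blast
    define H where "H = {h \<in> K. act h x0 = x0}"
    have act_inv: "act (inv h) x = x" if "h \<in> carrier G" "act h x = x" for h x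
      using act_mult[of "inv h" h x] act_one[of x] that by simp
    have H: "subgroup H G"
    proof (rule subgroupI)
      show "H \<subseteq> carrier G" using Kc by (auto simp: H_def)
      show "H \<noteq> {}" using subgroup.one_closed[OF K] act_one by (auto simp: H_def)
      show "inv h \<in> H" if "h \<in> H" for h
        using that act_inv Kc subgroup.m_inv_closed[OF K] by (auto simp: H_def)
      show "h \<otimes> k \<in> H" if "h \<in> H" "k \<in> H" for h k
        using that act_mult[of h k x0] Kc subgroup.m_closed[OF K] by (auto simp: H_def)
    qed
    have HK: "H \<subseteq> K" by (auto simp: H_def)
    have Hg: "\<forall>i::int. g [^] i \<in> H \<longrightarrow> g [^] i = \<one>"
      using cyclic_p_subgroup_trivial_meet[OF H gc p ordg] x0 by (auto simp: H_def)
    obtain L where L: "subgroup L G" and HL: "H \<subseteq> L" and LK: "L \<subseteq> K"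
      and Lg: "\<And>i::int. g [^] i \<in> L \<Longrightarrow> g [^] i = \<one>"
      and KL: "K = {g [^] i \<otimes> l | (i::int) l. l \<in> L}"
      using cyclic_p_subgroup_complement[OF fin K gK p ordg maxg H HK Hg] by blast
    have Lc: "L \<subseteq> carrier G" using L subgroup.subset by blast
    have "p dvd p ^ Suc a" "p ^ Suc a > 0" using p2 by auto
    then have pa2: "2 \<le> p ^ Suc a" using p2 dvd_imp_le le_trans by blast
    have "g \<noteq> \<one>"
    proof
      assume "g = \<one>"
      then have "p ^ Suc a = 1" using ordg ord_id by simp
      then show False using pa2 by simp
    qed
    then have "g \<notin> L" using Lg[of 1] gc by auto
    then have "L \<subset> K" using LK gK by blast
    then have less: "card L < card K" using finite_subset[OF Kc fin] psubset_card_mono by blast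
    define Obt where "Obt = (\<lambda>k. act k x0) ` K"
    define C where "C = (\<lambda>l. act l x0) ` L"
    have CO: "C \<subseteq> Obt" unfolding C_def Obt_def using LK by (rule image_mono)
    have OX: "Obt \<subseteq> X" unfolding Obt_def using inv x0(1) by (intro image_subsetI) blast
    have finO: "finite Obt" using OX finX by (rule finite_subset)
    have finC: "finite C" using CO finO by (rule finite_subset)
    have "act \<one> x0 \<in> C" unfolding C_def using subgroup.one_closed[OF L] by (rule imageI)
    then have x0C: "x0 \<in> C" by (simp only: act_one)
    \<comment> \<open>The translates of \<open>C\<close> by distinct powers of \<open>g\<close> are disjoint, since \<open>L\<close> contains the
      stabilizer of \<open>x0\<close>.\<close>
    have OC: "p ^ Suc a * card C \<le> card Obt"
    proof -
      let ?f = "\<lambda>(i::nat, c). act (g [^] int i) c"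
      have "inj_on ?f ({..<p ^ Suc a} \<times> C)"
      proof (rule inj_onI)
        fix r s
        assume rs: "r \<in> {..<p ^ Suc a} \<times> C" "s \<in> {..<p ^ Suc a} \<times> C" "?f r = ?f s"
        obtain i c j d where r: "r = (i, c)" and s: "s = (j, d)" by (cases r, cases s) blast
        have i: "i < p ^ Suc a" and j: "j < p ^ Suc a" and cd: "c \<in> C" "d \<in> C"
          using rs unfolding r s by (simp_all del: power_Suc)
        have eq: "act (g [^] int i) c = act (g [^] int j) d"
          using rs(3) unfolding r s by simp
        obtain l where l: "l \<in> L" "c = act l x0" using cd unfolding C_def by blast
        obtain m where m: "m \<in> L" "d = act m x0" using cd unfolding C_def by blast
        have lc: "l \<in> carrier G" "m \<in> carrier G" using l m Lc by auto
        define u v where "u = g [^] int i \<otimes> l" and "v = g [^] int j \<otimes> m"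
        have uv: "u \<in> carrier G" "v \<in> carrier G" using lc gc by (auto simp: u_def v_def)
        have "act u x0 = act v x0"
          unfolding u_def v_def using eq l m lc gc act_mult[of "g [^] int i" l] act_mult[of "g [^] int j" m] by simp
        then have "act (inv v \<otimes> u) x0 = act (inv v \<otimes> v) x0"
          using uv act_mult[of "inv v" u] act_mult[of "inv v" v] by simp
        then have "act (inv v \<otimes> u) x0 = x0" using uv act_one by simp
        moreover have "inv v \<otimes> u = g [^] (int i - int j) \<otimes> (inv m \<otimes> l)"
          unfolding u_def v_def using lc gc by (simp add: inv_mult int_pow_diff m_ac)
        moreover have "g [^] (int i - int j) \<otimes> (inv m \<otimes> l) \<in> K"
          using KL subgroup.m_closed[OF L subgroup.m_inv_closed[OF L m(1)] l(1)] by blast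
        ultimately have "g [^] (int i - int j) \<otimes> (inv m \<otimes> l) \<in> L" using HL by (auto simp: H_def)
        then have "g [^] (int i - int j) \<otimes> (inv m \<otimes> l) \<otimes> inv (inv m \<otimes> l) \<in> L"
          by (rule subgroup.m_closed[OF L _ subgroup.m_inv_closed[OF L
                subgroup.m_closed[OF L subgroup.m_inv_closed[OF L m(1)] l(1)]]])
        then have "g [^] (int i - int j) \<in> L" using lc gc by (simp add: m_assoc)
        then have "int (p ^ Suc a) dvd int i - int j"
          using Lg int_pow_eq_id[OF gc] ordg by metis
        then have "int i mod int (p ^ Suc a) = int j mod int (p ^ Suc a)" by (simp only: mod_eq_dvd_iff)
        then have ij: "i = j" using i j by (simp flip: of_nat_mod of_nat_power del: power_Suc)
        define h where "h = g [^] int j"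
        have h: "h \<in> carrier G" and eqh: "act h c = act h d" using gc eq ij by (auto simp: h_def)
        then have "act (inv h \<otimes> h) c = act (inv h \<otimes> h) d"
          by (simp only: act_mult[OF inv_closed[OF h] h])
        then have "c = d" using h act_one by simp
        then show "r = s" using ij r s by simp
      qed
      moreover have "?f ` ({..<p ^ Suc a} \<times> C) \<subseteq> Obt"
      proof clarify
        fix i :: nat and c assume "c \<in> C"
        then obtain l where l: "l \<in> L" "c = act l x0" by (auto simp: C_def)
        have "act (g [^] int i) c = act (g [^] int i \<otimes> l) x0" using l Lc gc act_mult by auto
        moreover have "g [^] int i \<otimes> l \<in> K" using KL l by blast
        ultimately show "act (g [^] int i) c \<in> Obt" by (auto simp: Obt_def)
      qed
      ultimately have "card ({..<p ^ Suc a} \<times> C) \<le> card Obt" using finO card_inj_on_le by blast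
      then show ?thesis by (simp add: card_cartesian_product)
    qed
    \<comment> \<open>If \<open>L\<close> fixes \<open>x0\<close>, the orbit may have no more points than the order of \<open>g\<close> uses up.\<close>
    define C' where "C' = (if card C = 1 then {} else C)"
    define Y where "Y = (X - Obt) \<union> C'"
    have C'C: "C' \<subseteq> C" by (auto simp: C'_def)
    have "finite Y" using finX finC C'C finite_subset by (auto simp: Y_def)
    have actC: "act l c \<in> C" if l: "l \<in> L" and "c \<in> C" for l c
    proof -
      obtain m where m: "m \<in> L" "c = act m x0" using \<open>c \<in> C\<close> by (auto simp: C_def)
      then have "act l c = act (l \<otimes> m) x0" using l Lc act_mult[of l m x0] by (simp add: subset_iff)
      then show ?thesis using subgroup.m_closed[OF L l m(1)] by (auto simp: C_def)
    qed
    have actO: "act k y \<notin> Obt" if k: "k \<in> K" and y: "y \<notin> Obt" for k y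
    proof
      assume "act k y \<in> Obt"
      then obtain h where h: "h \<in> K" "act k y = act h x0" by (auto simp: Obt_def)
      have kc: "k \<in> carrier G" "h \<in> carrier G" using k h Kc by auto
      have "y = act (inv k \<otimes> k) y" using act_one kc by simp
      also have "\<dots> = act (inv k \<otimes> h) x0"
        using kc h act_mult[of "inv k" k y] act_mult[of "inv k" h x0] by simp
      finally show False
        using y subgroup.m_closed[OF K subgroup.m_inv_closed[OF K k] h(1)] by (auto simp: Obt_def)
    qed
    have invY: "act l y \<in> Y" if l: "l \<in> L" and y: "y \<in> Y" for l y
    proof (cases "y \<in> C'")
      case True
      then show ?thesis using actC[OF l, of y] by (auto simp: Y_def C'_def split: if_splits)
    next
      case False
      then have "y \<in> X" "y \<notin> Obt" using y by (auto simp: Y_def)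
      then show ?thesis using inv actO l LK by (auto simp: Y_def)
    qed
    have faithY: "l = \<one>" if l: "l \<in> L" and fx: "\<And>y. y \<in> Y \<Longrightarrow> act l y = y" for l
    proof (rule faith)
      show "l \<in> K" using l LK by blast
      have lx0: "act l x0 = x0"
      proof (cases "card C = 1")
        case True
        then have "C = {x0}" using x0C by (metis card_1_singletonE singletonD)
        then show ?thesis using actC[OF l x0C] by simp
      next
        case False
        then show ?thesis using fx x0C by (auto simp: Y_def C'_def)
      qed
      fix x assume "x \<in> X"
      show "act l x = x"
      proof (cases "x \<in> Obt")
        case True
        then obtain k where k: "k \<in> K" "x = act k x0" by (auto simp: Obt_def)
        have "act l x = act k (act l x0)"
          using k l Kc Lc act_mult[of l k x0] act_mult[of k l x0] m_comm[of l k]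
          by (simp add: subset_iff)
        then show ?thesis using lx0 k by simp
      next
        case False
        then show ?thesis using fx \<open>x \<in> X\<close> by (auto simp: Y_def)
      qed
    qed
    obtain gs where gs: "cyclic_basis gs L" "sum_list (map ord gs) \<le> card Y"
      using less.hyps[of L Y] less L \<open>finite Y\<close> invY faithY by metis
    have "card Y \<le> card (X - Obt) + card C'" unfolding Y_def by (rule card_Un_le)
    also have "card (X - Obt) = card X - card Obt" using card_Diff_subset[OF finO OX] .
    finally have cY: "card Y \<le> card X - card Obt + card C'" .
    have cO: "card Obt \<le> card X" using card_mono[OF finX OX] .
    have "p ^ Suc a + card C' \<le> card Obt"
    proof (cases "card C = 1")
      case True
      then show ?thesis using OC by (simp add: C'_def)
    next
      case False
      have "card C \<noteq> 0" using x0C finC by auto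
      then have "2 \<le> card C" using False by linarith
      then have "p ^ Suc a + card C \<le> card Obt"
        using OC add_le_mult_nat[OF pa2, of "card C"] by linarith
      then show ?thesis using False by (simp add: C'_def)
    qed
    then have "sum_list (map ord (g # gs)) \<le> card X" using gs cY cO ordg by simp
    moreover have "cyclic_basis (g # gs) K" using cyclic_basis_Cons[OF gs(1) L gc Lg] KL by simp
    ultimately show ?thesis by blast
  qed
qed

lemma (in comm_group) cyclic_basis_pad:
  assumes "cyclic_basis gs K" "subgroup K G" "sum_list (map ord gs) \<le> n"
  shows "\<exists>hs. cyclic_basis hs K \<and> sum_list (map ord hs) = n"
proof -
  have Kc: "K \<subseteq> carrier G" using assms(2) subgroup.subset by blast
  have "{\<one> [^] i \<otimes> l | (i::int) l. l \<in> K} = K" using Kc by force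
  then have one: "cyclic_basis (\<one> # hs) K" if "cyclic_basis hs K" for hs
    using cyclic_basis_Cons[OF that assms(2) one_closed] by simp
  have "cyclic_basis (replicate d \<one> @ gs) K" for d
    by (induction d) (auto simp: assms(1) one)
  moreover have "sum_list (map ord (replicate d \<one> @ gs)) = d + sum_list (map ord gs)" for d
    by (induction d) auto
  ultimately show ?thesis using assms(3) by (metis le_add_diff_inverse2)
qed

section \<open>Letter counts in the factors of a Sturmian word\<close>

definition occ :: "(nat \<Rightarrow> 'a) \<Rightarrow> 'a \<Rightarrow> nat \<Rightarrow> nat \<Rightarrow> nat" where
  "occ x a i m = count_list (map x [i..<i + m]) a"

lemma occ_0 [simp]: "occ x a i 0 = 0"
  by (simp add: occ_def)

lemma occ_add: "occ x a i (m + n) = occ x a i m + occ x a (i + m) n"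
proof -
  have "[i..<i + (m + n)] = [i..<i + m] @ [i + m..<i + m + n]"
    using upt_add_eq_append[of i "i + m" n] by (simp add: add.assoc)
  then show ?thesis by (simp add: occ_def)
qed

lemma occ_Suc: "occ x a i (Suc m) = occ x a i m + of_bool (x (i + m) = a)"
  by (simp add: occ_def)

lemma occ_Suc_left: "occ x a i (Suc m) = of_bool (x i = a) + occ x a (Suc i) m"
  using occ_add[of x a i 1 m] occ_Suc[of x a i 0] by simp

lemma occ_eq_card: "occ x a i m = card {j. j < m \<and> x (i + j) = a}"
proof (induction m)
  case (Suc m)
  have "{j. j < Suc m \<and> x (i + j) = a} =
      (if x (i + m) = a then insert m {j. j < m \<and> x (i + j) = a} else {j. j < m \<and> x (i + j) = a})"
    by (auto simp: less_Suc_eq)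
  then show ?case using Suc by (simp add: occ_Suc)
qed simp

text \<open>In a balanced word the number of occurrences of a letter in a window of length \<open>m\<close> takes at
  most two values; this is the smaller one.\<close>

definition low :: "(nat \<Rightarrow> 'a) \<Rightarrow> 'a \<Rightarrow> nat \<Rightarrow> nat" where
  "low x a m = (LEAST k. \<exists>i. occ x a i m = k)"

locale sturmian_word =
  fixes x :: "nat \<Rightarrow> 'a" and a b :: 'a
  assumes sturmian: "sturmian x" and range_x: "range x = {a, b}" and a_neq_b: "a \<noteq> b"
begin

lemma letter_cases: "x i = a \<or> x i = b"
  using range_x by blast

lemma letters_eq_iff: "x i = x j \<longleftrightarrow> (x i = a \<longleftrightarrow> x j = a)"
  using letter_cases[of i] letter_cases[of j] a_neq_b by auto

lemma occ_balanced: "occ x a i m \<le> occ x a j m + 1"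
proof -
  have "map x [i..<i + m] \<in> Fact x m" "map x [j..<j + m] \<in> Fact x m" by (auto simp: Fact_def)
  then have "\<bar>int (occ x a i m) - int (occ x a j m)\<bar> \<le> 1"
    using sturmian unfolding sturmian_def balanced_def occ_def by blast
  then show ?thesis by linarith
qed

text \<open>Sliding the window by one position removes one letter and adds another. If the count never
  changes, the two letters always agree and \<open>m\<close> is a period.\<close>

lemma occ_not_constant:
  assumes "m > 0" shows "\<exists>i j. occ x a i m \<noteq> occ x a j m"
proof (rule ccontr)
  assume "\<not> ?thesis"
  then have const: "occ x a i m = occ x a j m" for i j by blast
  have "x (i + m) = x i" for i
    using occ_Suc[of x a i m] occ_Suc_left[of x a i m] const[of i "Suc i"]
    by (auto simp: letters_eq_iff of_bool_def split: if_splits)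
  then have "ultimately_periodic x" using assms unfolding ultimately_periodic_def by blast
  then show False using sturmian by (simp add: sturmian_def aperiodic_def)
qed

lemma low_attained: "\<exists>i. occ x a i m = low x a m"
  unfolding low_def by (rule LeastI_ex) blast

lemma low_le: "low x a m \<le> occ x a i m"
  unfolding low_def by (rule Least_le) blast

lemma occ_le_Suc_low: "occ x a i m \<le> Suc (low x a m)"
  using low_attained[of m] occ_balanced[of i m] by (metis Suc_eq_plus1)

lemma Suc_low_attained:
  assumes "m > 0" shows "\<exists>i. occ x a i m = Suc (low x a m)"
proof (rule ccontr)
  assume "\<not> ?thesis"
  then have "occ x a i m = low x a m" for i
    using low_le[of m i] occ_le_Suc_low[of i m] by (metis le_antisym not_less_eq_eq)
  then show False using occ_not_constant[OF assms] by simp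
qed

lemma mult_low_le_occ: "t * low x a s \<le> occ x a i (t * s)"
proof (induction t arbitrary: i)
  case (Suc t)
  show ?case using Suc[of "i + s"] low_le[of s i] by (simp add: occ_add)
qed simp

lemma occ_le_mult_Suc_low: "occ x a i (t * s) \<le> t * Suc (low x a s)"
proof (induction t arbitrary: i)
  case (Suc t)
  show ?case using Suc[of "i + s"] occ_le_Suc_low[of i s] by (simp add: occ_add)
qed simp

text \<open>Cutting a window of length \<open>t * s\<close> into pieces of length \<open>s\<close>, or into pieces of length \<open>t\<close>,
  bounds its count from below and from above. Both values \<open>low\<close> and \<open>low + 1\<close> occur for this
  length, which makes the resulting inequality strict.\<close>

lemma low_ratio_less:
  assumes "s > 0" "t > 0"
  shows "t * low x a s < s * Suc (low x a t)"
proof -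
  obtain i where i: "occ x a i (t * s) = low x a (t * s)" using low_attained by blast
  obtain j where j: "occ x a j (t * s) = Suc (low x a (t * s))"
    using Suc_low_attained[of "t * s"] assms by auto
  show ?thesis
    using mult_low_le_occ[of t s i] occ_le_mult_Suc_low[of j s t] i j by (simp add: mult.commute)
qed

text \<open>A single number \<open>\<alpha>\<close> gives \<open>low r = \<lfloor>r \<alpha>\<rfloor>\<close> for all lengths \<open>r\<close> from \<open>1\<close> to \<open>m\<close>, and \<open>r \<alpha>\<close> is
  never an integer there. For a bounded range of lengths any number strictly between the lower and the upper
  density bounds qualifies, so no limit has to be taken and \<open>\<alpha>\<close> may be rational.\<close>

lemma slope_exists:
  "\<exists>\<alpha>::real. \<forall>r\<in>{1..m}. real (low x a r) < real r * \<alpha> \<and> real r * \<alpha> < real (low x a r) + 1"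
proof (cases "m = 0")
  case False
  define A where "A = (\<lambda>r. real (low x a r) / real r) ` {1..m}"
  define B where "B = (\<lambda>r. (real (low x a r) + 1) / real r) ` {1..m}"
  have fin: "finite A" "finite B" "A \<noteq> {}" "B \<noteq> {}" using False by (auto simp: A_def B_def)
  have AB: "u < v" if uv: "u \<in> A" "v \<in> B" for u v
  proof -
    obtain s t where s: "s \<in> {1..m}" "u = real (low x a s) / real s"
      and t: "t \<in> {1..m}" "v = (real (low x a t) + 1) / real t" using uv by (auto simp: A_def B_def)
    have "t * low x a s < s * Suc (low x a t)" using low_ratio_less s t by auto
    then have "real (t * low x a s) < real (s * Suc (low x a t))" by (simp only: of_nat_less_iff)
    then have "real (low x a s) * real t < (real (low x a t) + 1) * real s"
      by (simp add: algebra_simps)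
    moreover have "real s > 0" "real t > 0" using s(1) t(1) by auto
    ultimately show ?thesis unfolding s(2) t(2) by (simp add: divide_simps)
  qed
  then have "Max A < Min B" using fin by simp
  then obtain \<alpha> where al: "Max A < \<alpha>" "\<alpha> < Min B" using dense by blast
  have "real (low x a r) < real r * \<alpha> \<and> real r * \<alpha> < real (low x a r) + 1" if r: "r \<in> {1..m}" for r
  proof -
    have "real (low x a r) / real r \<in> A" "(real (low x a r) + 1) / real r \<in> B"
      using r by (auto simp: A_def B_def)
    then have "real (low x a r) / real r < \<alpha>" "\<alpha> < (real (low x a r) + 1) / real r"
      using al fin by (meson Max_ge Min_le le_less_trans less_le_trans)+
    then show ?thesis using r by (simp add: divide_simps mult.commute)
  qed
  then show ?thesis by blast
qed auto

lemma low_1: "low x a 1 = 0"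
proof -
  obtain i where "occ x a i 1 = Suc (low x a 1)" using Suc_low_attained[of 1] by auto
  then show ?thesis using occ_Suc[of x a i 0] by (auto simp: of_bool_def split: if_splits)
qed

text \<open>Every factor of length \<open>m\<close> is coded by a line of the common slope \<open>\<alpha>\<close>. The intercept has to
  be at least all numbers \<open>occ s - s \<alpha>\<close> and less than all numbers \<open>occ t + 1 - t \<alpha>\<close>; comparing \<open>s\<close> with
  \<open>t\<close> amounts to counting in the window between these positions.\<close>

lemma intercept_exists:
  assumes slope: "\<forall>r\<in>{1..m}. real (low x a r) < real r * \<alpha> \<and> real r * \<alpha> < real (low x a r) + 1"
  shows "\<exists>\<rho>. 0 \<le> \<rho> \<and> \<rho> < 1 \<and> (\<forall>s\<le>m. \<lfloor>real s * \<alpha> + \<rho>\<rfloor> = int (occ x a i s))"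
proof -
  define A where "A = (\<lambda>s. real (occ x a i s) - real s * \<alpha>) ` {..m}"
  have gap: "real (occ x a i s) - real s * \<alpha> < real (occ x a i t) + 1 - real t * \<alpha>"
    if st: "s \<le> m" "t \<le> m" for s t
  proof (rule linorder_cases[of s t])
    assume "s < t"
    define r where "r = t - s"
    have r: "t = s + r" "r \<in> {1..m}" using \<open>s < t\<close> st by (auto simp: r_def)
    have "real r * \<alpha> < real (low x a r) + 1" using slope r by blast
    then show ?thesis using low_le[of r "i + s"] r occ_add[of x a i s r] by (simp add: algebra_simps)
  next
    assume "t < s"
    define r where "r = s - t"
    have r: "s = t + r" "r \<in> {1..m}" using \<open>t < s\<close> st by (auto simp: r_def)
    have "real (low x a r) < real r * \<alpha>" using slope r by blast
    then show ?thesis using occ_le_Suc_low[of "i + t" r] r occ_add[of x a i t r] by (simp add: algebra_simps)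
  qed simp
  have A: "finite A" "A \<noteq> {}" by (auto simp: A_def)
  have lo: "real (occ x a i s) - real s * \<alpha> \<le> Max A" if "s \<le> m" for s
    using A that by (intro Max_ge) (auto simp: A_def)
  have hi: "Max A < real (occ x a i t) + 1 - real t * \<alpha>" if "t \<le> m" for t
    using Max_in[OF A] gap that by (auto simp: A_def)
  show ?thesis
    using lo[of 0] hi[of 0] lo hi
    by (intro exI[of _ "Max A"]) (auto intro!: floor_unique simp: algebra_simps)
qed

end

text \<open>Going up a chain of subsets of \<open>B\<close>, each step adds exactly one element, as two elements entering
  together would not be separated. So the members of the chain have the sizes \<open>0, \<dots>, card B\<close>,
  each exactly once.\<close>

lemma card_separating_chain:
  assumes B: "finite B" and C: "C \<subseteq> Pow B" "C \<noteq> {}"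
    and chain: "\<And>S T. S \<in> C \<Longrightarrow> T \<in> C \<Longrightarrow> S \<subseteq> T \<or> T \<subseteq> S"
    and mem: "\<And>s. s \<in> B \<Longrightarrow> \<exists>T\<in>C. s \<in> T" and nmem: "\<And>s. s \<in> B \<Longrightarrow> \<exists>T\<in>C. s \<notin> T"
    and sep: "\<And>s t. s \<in> B \<Longrightarrow> t \<in> B \<Longrightarrow> s \<noteq> t \<Longrightarrow> \<exists>T\<in>C. (s \<in> T) \<noteq> (t \<in> T)"
  shows "card C = Suc (card B)"
proof -
  have finC: "finite C" using B C finite_subset by blast
  have finT: "finite T" if "T \<in> C" for T using that C B finite_subset by blast
  have "inj_on card C"
  proof (rule inj_onI)
    fix S T assume "S \<in> C" "T \<in> C" "card S = card T"
    then show "S = T" using chain[of S T] finT card_subset_eq[of S T] card_subset_eq[of T S] by auto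
  qed
  moreover have "card ` C = {..card B}"
  proof
    show "card ` C \<subseteq> {..card B}" using C B by (auto intro: card_mono)
    have "\<exists>T\<in>C. card T = c" if "c \<le> card B" for c
      using that
    proof (induction c)
      case 0
      obtain T where T: "T \<in> C" "\<forall>S\<in>C. S \<subseteq> T \<longrightarrow> T = S"
        using finite_has_minimal[OF finC C(2)] by blast
      have "T = {}"
      proof (rule ccontr)
        assume "T \<noteq> {}"
        then obtain s where s: "s \<in> T" by blast
        then obtain S where "S \<in> C" "s \<notin> S" using nmem C T by blast
        then show False using chain[of S T] T s by blast
      qed
      then show ?case using T(1) by (intro bexI[of _ T]) simp_all
    next
      case (Suc c)
      then obtain A where A: "A \<in> C" "card A = c" by auto
      define D where "D = {T \<in> C. A \<subset> T}"
      have "A \<noteq> B" using A Suc.prems by auto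
      then obtain s where "s \<in> B" "s \<notin> A" using C A by blast
      then obtain T where "T \<in> C" "s \<in> T" using mem by blast
      then have "T \<in> D" using chain[of A T] A \<open>s \<notin> A\<close> by (auto simp: D_def)
      moreover have "finite D" using finC by (simp add: D_def)
      ultimately obtain E where E: "E \<in> D" "\<forall>S\<in>D. S \<subseteq> E \<longrightarrow> E = S"
        using finite_has_minimal[of D] by blast
      have EC: "E \<in> C" "A \<subset> E" using E by (auto simp: D_def)
      then obtain s where s: "s \<in> E" "s \<notin> A" by blast
      have "t = s" if t: "t \<in> E" "t \<notin> A" for t
      proof (rule ccontr)
        assume "t \<noteq> s"
        then obtain T where T: "T \<in> C" "(s \<in> T) \<noteq> (t \<in> T)" using sep[of s t] s t EC C by blast
        then have "A \<subset> T" using chain[of A T] A s t by blast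
        then have "T \<in> D" using T by (simp add: D_def)
        moreover have "T \<subseteq> E" using chain[of T E] T EC s t by blast
        ultimately show False using E T s t by blast
      qed
      then have "E = insert s A" using s EC by blast
      then have "card E = Suc c" using A s finT by simp
      then show ?case using EC by blast
    qed
    then show "{..card B} \<subseteq> card ` C" by (metis atMost_iff imageI subsetI)
  qed
  ultimately show ?thesis using card_image[of card C] by simp
qed

context sturmian_word begin

text \<open>Call a window heavy if its count exceeds the smaller value, and light otherwise. The sets of
  lengths of heavy windows starting at \<open>i\<close> and at \<open>j\<close> are comparable: if the windows at \<open>i\<close> and \<open>j\<close> were heavy at \<open>s\<close> and at \<open>t\<close> respectively, and light at the other
  length, the counts between the positions \<open>s\<close> and \<open>t\<close> would differ by two. Different lengths are
  separated, since otherwise the count in windows of length \<open>t - s\<close> would eventually be constant and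
  the word ultimately periodic.\<close>

lemma card_occurrence_sets:
  assumes B: "finite B" "0 \<notin> B"
  shows "card (range (\<lambda>i. {s \<in> B. low x a s < occ x a i s})) = Suc (card B)"
proof (rule card_separating_chain[OF B(1)])
  have comp: "\<not> (low x a s < occ x a i s \<and> occ x a j s = low x a s \<and>
      low x a t < occ x a j t \<and> occ x a i t = low x a t)" if "s < t" for s t i j
  proof -
    obtain r where r: "t = s + r" using \<open>s < t\<close> less_imp_add_positive by blast
    show ?thesis
      using occ_add[of x a i s r] occ_add[of x a j s r] occ_balanced[of "j + s" r "i + s"] r by auto
  qed
  have eqlow: "occ x a i s = low x a s" if "\<not> low x a s < occ x a i s" for i s
    using low_le[of s i] that by simp
  let ?T = "\<lambda>i. {s \<in> B. low x a s < occ x a i s}"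
  fix S T assume "S \<in> range ?T" "T \<in> range ?T"
  then obtain i j where S: "S = ?T i" and T: "T = ?T j" by blast
  show "S \<subseteq> T \<or> T \<subseteq> S"
  proof (rule ccontr)
    assume "\<not> ?thesis"
    then obtain s t where "s \<in> S" "s \<notin> T" "t \<in> T" "t \<notin> S" by blast
    then show False
      using comp[of s t i j] comp[of t s j i] eqlow[of s j] eqlow[of t i]
      by (cases s t rule: linorder_cases) (auto simp: S T)
  qed
next
  let ?T = "\<lambda>i. {s \<in> B. low x a s < occ x a i s}"
  fix s t assume st: "s \<in> B" "t \<in> B" "s \<noteq> t"
  have "\<exists>i. (low x a s < occ x a i s) \<noteq> (low x a t < occ x a i t)" if "s < t" for s t
  proof (rule ccontr)
    assume *: "\<not> ?thesis"
    define r where "r = t - s"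
    have r: "t = s + r" "r > 0" using \<open>s < t\<close> by (auto simp: r_def)
    have c: "occ x a (i + s) r + low x a s = low x a t" for i
    proof -
      have "low x a s < occ x a i s \<longleftrightarrow> low x a t < occ x a i t" using * by blast
      moreover have "occ x a i t = occ x a i s + occ x a (i + s) r" using occ_add[of x a i s r] r by simp
      ultimately show ?thesis
        using low_le[of s i] low_le[of t i] occ_le_Suc_low[of i s] occ_le_Suc_low[of i t] by linarith
    qed
    have c': "occ x a i r = low x a t - low x a s" if "i \<ge> s" for i
      using c[of "i - s"] that by simp
    have "x (i + r) = x i" if "i \<ge> s" for i
      using occ_Suc[of x a i r] occ_Suc_left[of x a i r] c'[of i] c'[of "Suc i"] that
      by (auto simp: letters_eq_iff of_bool_def split: if_splits)
    then have "ultimately_periodic x" using r unfolding ultimately_periodic_def by blast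
    then show False using sturmian by (simp add: sturmian_def aperiodic_def)
  qed
  then have "\<exists>i. (low x a s < occ x a i s) \<noteq> (low x a t < occ x a i t)"
    using st by (metis linorder_neqE_nat)
  then show "\<exists>T\<in>range ?T. (s \<in> T) \<noteq> (t \<in> T)" using st by auto
next
  let ?T = "\<lambda>i. {s \<in> B. low x a s < occ x a i s}"
  fix s assume s: "s \<in> B"
  then have "s > 0" using B by (cases s) auto
  then obtain i where "occ x a i s = Suc (low x a s)" using Suc_low_attained by blast
  then have "s \<in> ?T i" using s by simp
  then show "\<exists>T\<in>range ?T. s \<in> T" by (rule bexI[of _ "?T i"]) (rule rangeI)
  obtain j where "occ x a j s = low x a s" using low_attained by blast
  then have "s \<notin> ?T j" by simp
  then show "\<exists>T\<in>range ?T. s \<notin> T" by (rule bexI[of _ "?T j"]) (rule rangeI)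
qed auto

end

section \<open>Factors as arcs of a circle\<close>

lemma monotone_threshold:
  fixes f :: "nat \<Rightarrow> real"
  assumes "\<And>k l. k \<le> l \<Longrightarrow> l < m \<Longrightarrow> f k \<le> f l"
  shows "\<exists>c\<le>m. \<forall>k<m. y \<le> f k \<longleftrightarrow> c \<le> k"
proof -
  define c where "c = (LEAST k. k = m \<or> y \<le> f k)"
  have c: "c = m \<or> y \<le> f c" unfolding c_def by (rule LeastI[of _ m]) simp
  have le: "c \<le> k" if "k = m \<or> y \<le> f k" for k unfolding c_def using that by (rule Least_le)
  have "y \<le> f k \<longleftrightarrow> c \<le> k" if "k < m" for k
    using c le[of k] assms[of c k] that by force
  then show ?thesis using le[of m] by blast
qed

lemma interval_cyclic:
  assumes "c \<le> d" "d \<le> m" "k < m"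
  shows "c \<le> k \<and> k < d \<longleftrightarrow> (int k - int c) mod int m < int (d - c)"
proof (cases "c \<le> k")
  case True
  then have "(int k - int c) mod int m = int k - int c" using assms by simp
  then show ?thesis using True assms by auto
next
  case False
  have "(int k - int c) mod int m = (int k - int c + int m) mod int m" by simp
  also have "\<dots> = int k - int c + int m" using False assms by (intro mod_pos_pos_trivial) auto
  finally show ?thesis using False assms by auto
qed

lemma interval_complement_cyclic:
  assumes "c \<le> d" "d \<le> m" "k < m"
  shows "k < c \<or> d \<le> k \<longleftrightarrow> (int k - int d) mod int m < int (m - (d - c))"
proof (cases "d \<le> k")
  case True
  then have "(int k - int d) mod int m = int k - int d" using assms by simp
  then show ?thesis using True assms by auto
next
  case False
  have "(int k - int d) mod int m = (int k - int d + int m) mod int m" by simp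
  also have "\<dots> = int k - int d + int m" using False assms by (intro mod_pos_pos_trivial) auto
  finally show ?thesis using False assms by auto
qed

lemma card_cyclic_interval:
  assumes "h \<le> m"
  shows "card {k. k < m \<and> (int k - s) mod int m < int h} = h"
proof (cases "m = 0")
  case False
  have "bij_betw (\<lambda>i. nat ((int i + s) mod int m)) {..<h} {k. k < m \<and> (int k - s) mod int m < int h}"
  proof (rule bij_betw_byWitness[where f' = "\<lambda>k. nat ((int k - s) mod int m)"])
    show "\<forall>i\<in>{..<h}. nat ((int (nat ((int i + s) mod int m)) - s) mod int m) = i"
      using assms False by (auto simp: mod_diff_left_eq)
    show "\<forall>k\<in>{k. k < m \<and> (int k - s) mod int m < int h}. nat ((int (nat ((int k - s) mod int m)) + s) mod int m) = k"
      using assms False by (auto simp: mod_add_left_eq)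
    show "(\<lambda>i. nat ((int i + s) mod int m)) ` {..<h} \<subseteq> {k. k < m \<and> (int k - s) mod int m < int h}"
      using assms False by (auto simp: mod_diff_left_eq nat_less_iff)
    show "(\<lambda>k. nat ((int k - s) mod int m)) ` {k. k < m \<and> (int k - s) mod int m < int h} \<subseteq> {..<h}"
      using False by (auto simp: nat_less_iff)
  qed
  then show ?thesis using bij_betw_same_card by fastforce
qed (use assms in auto)

context sturmian_word begin

text \<open>Put position \<open>j\<close> at the point \<open>frac (j \<alpha>)\<close> of the circle of length one. In a factor with
  intercept \<open>\<rho>\<close>, the letter \<open>a\<close> stands at the positions with \<open>frac (j \<alpha> + \<rho>) \<ge> 1 - \<alpha>\<close>, that is, at
  the points of an arc of length \<open>\<alpha>\<close>. When \<open>p\<close> lists the positions in circular order, these are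
  cyclically consecutive entries of the list, and their number is the number of occurrences of
  \<open>a\<close>.\<close>

lemma factor_is_cyclic_interval:
  assumes m: "m > 0"
    and slope: "\<forall>r\<in>{1..m}. real (low x a r) < real r * \<alpha> \<and> real r * \<alpha> < real (low x a r) + 1"
    and p: "bij_betw p {..<m} {..<m}"
    and mono: "\<And>k l. k \<le> l \<Longrightarrow> l < m \<Longrightarrow> frac (real (p k) * \<alpha>) \<le> frac (real (p l) * \<alpha>)"
  shows "\<exists>s. \<forall>k<m. x (i + p k) = a \<longleftrightarrow> (int k - s) mod int m < int (occ x a i m)"
proof -
  obtain \<rho> where rho: "0 \<le> \<rho>" "\<rho> < 1"
    and fl: "\<And>s. s \<le> m \<Longrightarrow> \<lfloor>real s * \<alpha> + \<rho>\<rfloor> = int (occ x a i s)"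
    using intercept_exists[OF slope, of i] by blast
  have al: "0 < \<alpha>" "\<alpha> < 1" using slope[rule_format, of 1] m low_1 by auto
  define th where "th j = frac (real j * \<alpha>)" for j
  have th: "0 \<le> th j" "th j < 1" for j by (auto simp: th_def frac_lt_1)
  have letter: "x (i + j) = a \<longleftrightarrow> (if th j < 1 - \<rho> then 1 - \<alpha> - \<rho> \<le> th j else 2 - \<alpha> - \<rho> \<le> th j)"
    if j: "j < m" for j
  proof -
    define c where "c = \<lfloor>real j * \<alpha>\<rfloor>"
    have e: "real j * \<alpha> = of_int c + th j" by (simp add: c_def th_def frac_def)
    have e1: "real (Suc j) * \<alpha> = of_int c + th j + \<alpha>" using e by (simp add: algebra_simps)
    have "\<lfloor>real (Suc j) * \<alpha> + \<rho>\<rfloor> = \<lfloor>real j * \<alpha> + \<rho>\<rfloor> + of_bool (x (i + j) = a)"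
      using fl[of "Suc j"] fl[of j] j by (simp add: occ_Suc)
    then have "\<lfloor>th j + \<alpha> + \<rho>\<rfloor> = \<lfloor>th j + \<rho>\<rfloor> + of_bool (x (i + j) = a)"
      unfolding e e1 by (simp add: add.assoc)
    then have "x (i + j) = a \<longleftrightarrow> \<lfloor>th j + \<alpha> + \<rho>\<rfloor> = \<lfloor>th j + \<rho>\<rfloor> + 1" by (cases "x (i + j) = a") auto
    moreover have "\<lfloor>th j + \<rho>\<rfloor> = (if th j < 1 - \<rho> then 0 else 1)"
      using th[of j] rho by (auto intro!: floor_unique)
    ultimately show ?thesis using th[of j] rho al
      by (auto simp: floor_eq_iff)
  qed
  have mono': "th (p k) \<le> th (p l)" if "k \<le> l" "l < m" for k l using mono[OF that] by (simp add: th_def)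
  have pm: "p k < m" if "k < m" for k using p that bij_betwE by blast
  \<comment> \<open>The arc does not contain the point \<open>0\<close> in its interior in the first case below and does in the second.\<close>
  have "\<exists>s h. h \<le> m \<and> (\<forall>k<m. x (i + p k) = a \<longleftrightarrow> (int k - s) mod int m < int h)"
  proof (cases "\<rho> \<le> 1 - \<alpha>")
    case True
    obtain c where c: "c \<le> m" "\<And>k. k < m \<Longrightarrow> 1 - \<alpha> - \<rho> \<le> th (p k) \<longleftrightarrow> c \<le> k"
      using monotone_threshold[of m "\<lambda>k. th (p k)" "1 - \<alpha> - \<rho>"] mono' by blast
    obtain d where d: "d \<le> m" "\<And>k. k < m \<Longrightarrow> 1 - \<rho> \<le> th (p k) \<longleftrightarrow> d \<le> k"
      using monotone_threshold[of m "\<lambda>k. th (p k)" "1 - \<rho>"] mono' by blast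
    have cd: "c \<le> d"
    proof (rule ccontr)
      assume "\<not> c \<le> d"
      then have "1 - \<rho> \<le> th (p d)" "\<not> 1 - \<alpha> - \<rho> \<le> th (p d)" using c d by auto
      then show False using al by linarith
    qed
    have "x (i + p k) = a \<longleftrightarrow> (int k - int c) mod int m < int (d - c)" if k: "k < m" for k
      unfolding interval_cyclic[OF cd d(1) k, symmetric]
      using letter[OF pm[OF k]] c(2)[OF k] d(2)[OF k] th[of "p k"] True by auto
    then show ?thesis using d by (intro exI[of _ "int c"] exI[of _ "d - c"]) auto
  next
    case False
    obtain c where c: "c \<le> m" "\<And>k. k < m \<Longrightarrow> 1 - \<rho> \<le> th (p k) \<longleftrightarrow> c \<le> k"
      using monotone_threshold[of m "\<lambda>k. th (p k)" "1 - \<rho>"] mono' by blast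
    obtain d where d: "d \<le> m" "\<And>k. k < m \<Longrightarrow> 2 - \<alpha> - \<rho> \<le> th (p k) \<longleftrightarrow> d \<le> k"
      using monotone_threshold[of m "\<lambda>k. th (p k)" "2 - \<alpha> - \<rho>"] mono' by blast
    have cd: "c \<le> d"
    proof (rule ccontr)
      assume "\<not> c \<le> d"
      then have "2 - \<alpha> - \<rho> \<le> th (p d)" "\<not> 1 - \<rho> \<le> th (p d)" using c d by auto
      then show False using al by linarith
    qed
    have "x (i + p k) = a \<longleftrightarrow> (int k - int d) mod int m < int (m - (d - c))" if k: "k < m" for k
      unfolding interval_complement_cyclic[OF cd d(1) k, symmetric]
      using letter[OF pm[OF k]] c(2)[OF k] d(2)[OF k] th[of "p k"] False al by auto
    then show ?thesis by (intro exI[of _ "int d"] exI[of _ "m - (d - c)"]) auto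
  qed
  then obtain s h where h: "h \<le> m" and s: "\<And>k. k < m \<Longrightarrow> x (i + p k) = a \<longleftrightarrow> (int k - s) mod int m < int h"
    by blast
  have "occ x a i m = card {j. j < m \<and> x (i + j) = a}" by (rule occ_eq_card)
  also have "{j. j < m \<and> x (i + j) = a} = p ` {k. k < m \<and> x (i + p k) = a}"
  proof
    show "p ` {k. k < m \<and> x (i + p k) = a} \<subseteq> {j. j < m \<and> x (i + j) = a}" using pm by auto
    show "{j. j < m \<and> x (i + j) = a} \<subseteq> p ` {k. k < m \<and> x (i + p k) = a}"
    proof
      fix j assume j: "j \<in> {j. j < m \<and> x (i + j) = a}"
      then have "j \<in> p ` {..<m}" using p by (simp add: bij_betw_def)
      then obtain k where "k < m" "j = p k" by auto
      then show "j \<in> p ` {k. k < m \<and> x (i + p k) = a}" using j by simp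
    qed
  qed
  also have "card \<dots> = card {k. k < m \<and> x (i + p k) = a}"
    using p by (intro card_image) (auto simp: bij_betw_def intro: inj_on_subset)
  also have "{k. k < m \<and> x (i + p k) = a} = {k. k < m \<and> (int k - s) mod int m < int h}"
    using s by blast
  also have "card \<dots> = h" using card_cyclic_interval[OF h] .
  finally show ?thesis using s by blast
qed

text \<open>Two cyclic intervals of equal length differ by a cyclic shift. The cycle through the positions in
  the order of the points \<open>frac (j \<alpha>)\<close> depends only on \<open>m\<close>, so it serves all factors of this length
  at once.\<close>

lemma equal_occ_factors_rotated:
  "\<exists>p. bij_betw p {..<m} {..<m} \<and>
    (\<forall>i j. occ x a i m = occ x a j m \<longrightarrow>
      (\<exists>e. \<forall>k<m. x (j + p (nat ((int k + e) mod int m))) = x (i + p k)))"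
proof (cases "m = 0")
  case False
  then have m: "m > 0" by simp
  obtain \<alpha> :: real where slope: "\<forall>r\<in>{1..m}. real (low x a r) < real r * \<alpha> \<and> real r * \<alpha> < real (low x a r) + 1"
    using slope_exists by blast
  define ps where "ps = sort_key (\<lambda>j. frac (real j * \<alpha>)) [0..<m]"
  have len: "length ps = m" and set: "set ps = {..<m}" and dist: "distinct ps"
    by (auto simp: ps_def lessThan_atLeast0)
  have p: "bij_betw ((!) ps) {..<m} {..<m}" using bij_betw_nth[OF dist] len set by simp
  have "sorted (map (\<lambda>j. frac (real j * \<alpha>)) ps)" unfolding ps_def by (rule sorted_sort_key)
  then have mono: "frac (real (ps ! k) * \<alpha>) \<le> frac (real (ps ! l) * \<alpha>)" if "k \<le> l" "l < m" for k l
    using that len by (auto simp: sorted_iff_nth_mono)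
  have "\<exists>e. \<forall>k<m. x (j + ps ! nat ((int k + e) mod int m)) = x (i + ps ! k)"
    if eq: "occ x a i m = occ x a j m" for i j
  proof -
    obtain s where s: "\<And>k. k < m \<Longrightarrow> x (i + ps ! k) = a \<longleftrightarrow> (int k - s) mod int m < int (occ x a i m)"
      using factor_is_cyclic_interval[OF m slope p mono, of i] by blast
    obtain t where t: "\<And>k. k < m \<Longrightarrow> x (j + ps ! k) = a \<longleftrightarrow> (int k - t) mod int m < int (occ x a j m)"
      using factor_is_cyclic_interval[OF m slope p mono, of j] by blast
    have "x (j + ps ! nat ((int k + (t - s)) mod int m)) = x (i + ps ! k)" if k: "k < m" for k
    proof -
      have "nat ((int k + (t - s)) mod int m) < m" using m by (simp add: nat_less_iff)
      moreover have "(int (nat ((int k + (t - s)) mod int m)) - t) mod int m = (int k - s) mod int m"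
        using m by (simp add: mod_diff_left_eq)
      ultimately show ?thesis unfolding letters_eq_iff using s[OF k] t eq by simp
    qed
    then show ?thesis by blast
  qed
  then show ?thesis using p by blast
qed (auto simp: bij_betw_def)

end

section \<open>Rotations of consecutive blocks\<close>

text \<open>The value \<open>p c k\<close> is the position that comes \<open>k\<close>-th in a cyclic arrangement of \<open>{..<c}\<close>; the \<open>e\<close>-th
  power of the cycle moves every position \<open>e\<close> places further in this arrangement.\<close>

definition rotation :: "(nat \<Rightarrow> nat \<Rightarrow> nat) \<Rightarrow> nat \<Rightarrow> int \<Rightarrow> nat \<Rightarrow> nat" where
  "rotation p c e j = p c (nat ((int (the_inv_into {..<c} (p c) j) + e) mod int c))"

text \<open>The interval of length \<open>sum_list cs\<close> is cut into consecutive blocks of lengths \<open>cs\<close>, and the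
  \<open>i\<close>-th block is rotated by \<open>e i\<close> independently of the others. Integer exponents make the parameter
  \<open>e\<close> range over a group.\<close>

primrec block_rotation :: "(nat \<Rightarrow> nat \<Rightarrow> nat) \<Rightarrow> nat list \<Rightarrow> (nat \<Rightarrow> int) \<Rightarrow> nat \<Rightarrow> nat" where
  "block_rotation p [] e j = j"
| "block_rotation p (c # cs) e j = (if j < c then rotation p c (e 0) j
     else c + block_rotation p cs (\<lambda>i. e (Suc i)) (j - c))"

primrec block_index :: "nat list \<Rightarrow> nat \<Rightarrow> nat" where
  "block_index [] j = 0"
| "block_index (c # cs) j = (if j < c then 0 else Suc (block_index cs (j - c)))"

locale cyclic_arrangements =
  fixes p :: "nat \<Rightarrow> nat \<Rightarrow> nat"
  assumes bij: "bij_betw (p c) {..<c} {..<c}"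
begin

lemma rotation_rank:
  assumes k: "k < c"
  shows "rotation p c e (p c k) = p c (nat ((int k + e) mod int c))"
  using bij[of c] k by (simp add: rotation_def bij_betw_def the_inv_into_f_f)

lemma rank_cases:
  assumes "j < (c::nat)"
  obtains k where "k < c" "j = (p c k :: nat)"
proof -
  have "j \<in> p c ` {..<c}" using assms bij[of c] by (simp add: bij_betw_def)
  then show ?thesis using that by auto
qed

lemma rotation_less:
  assumes j: "j < c"
  shows "rotation p c e j < c"
proof -
  have "nat ((int k + e) mod int c) < c" for k using j by (simp add: nat_less_iff)
  then have "p c (nat ((int k + e) mod int c)) < c" for k
    using bij[of c] by (metis bij_betwE lessThan_iff)
  then show ?thesis by (simp add: rotation_def)
qed

lemma rotation_0:
  assumes j: "j < c"
  shows "rotation p c 0 j = j"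
proof -
  obtain k where k: "k < c" "j = p c k" using rank_cases[OF j] by blast
  show ?thesis unfolding k(2) rotation_rank[OF k(1)] using k(1) by simp
qed

lemma rotation_add:
  assumes j: "j < c"
  shows "rotation p c e (rotation p c f j) = rotation p c (e + f) j"
proof -
  obtain k where k: "k < c" "j = p c k" using rank_cases[OF j] by blast
  have l: "nat ((int k + f) mod int c) < c" using j by (simp add: nat_less_iff)
  have "(int (nat ((int k + f) mod int c)) + e) mod int c = (int k + (e + f)) mod int c"
    using j by (simp add: mod_add_left_eq add.assoc add.commute[of e])
  then show ?thesis
    unfolding k(2) rotation_rank[OF k(1)] rotation_rank[OF l] by simp
qed

lemma rotation_eq_iff:
  assumes j: "j < c"
  shows "rotation p c e j = rotation p c f j \<longleftrightarrow> int c dvd e - f"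
proof -
  obtain k where k: "k < c" "j = p c k" using rank_cases[OF j] by blast
  have l: "nat ((int k + e) mod int c) < c" for e using j by (simp add: nat_less_iff)
  have "rotation p c e j = rotation p c f j \<longleftrightarrow> nat ((int k + e) mod int c) = nat ((int k + f) mod int c)"
    unfolding k(2) rotation_rank[OF k(1)] using inj_on_eq_iff[OF bij_betw_imp_inj_on[OF bij[of c]]] l by simp
  also have "\<dots> \<longleftrightarrow> (int k + e) mod int c = (int k + f) mod int c"
    using j by (simp add: nat_eq_iff)
  also have "\<dots> \<longleftrightarrow> int c dvd e - f" by (simp add: mod_eq_dvd_iff)
  finally show ?thesis .
qed

lemma rotation_transitive:
  assumes j: "j < c" "j' < c"
  shows "\<exists>e. rotation p c e j = j'"
proof -
  obtain k where k: "k < c" "j = p c k" using rank_cases[OF j(1)] by blast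
  obtain l where l: "l < c" "j' = p c l" using rank_cases[OF j(2)] by blast
  have "rotation p c (int l - int k) j = j'"
    unfolding k(2) rotation_rank[OF k(1)] using l by simp
  then show ?thesis by blast
qed

lemma block_rotation_less: "j < sum_list cs \<Longrightarrow> block_rotation p cs e j < sum_list cs"
proof (induction cs arbitrary: e j)
  case (Cons c cs)
  show ?case
  proof (cases "j < c")
    case True
    then show ?thesis using rotation_less[of j c "e 0"] by simp
  next
    case False
    then show ?thesis using Cons.IH[of "j - c"] Cons.prems by simp
  qed
qed simp

lemma block_rotation_ge: "sum_list cs \<le> j \<Longrightarrow> block_rotation p cs e j = j"
  by (induction cs arbitrary: e j) auto

lemma block_rotation_0: "block_rotation p cs (\<lambda>_. 0) j = j"
  by (induction cs arbitrary: j) (auto simp: rotation_0)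

lemma block_rotation_add:
  "block_rotation p cs e (block_rotation p cs f j) = block_rotation p cs (\<lambda>i. e i + f i) j"
proof (induction cs arbitrary: e f j)
  case (Cons c cs)
  then show ?case by (auto simp: rotation_add rotation_less)
qed simp

lemma block_rotation_eq_iff:
  assumes "0 \<notin> set cs"
  shows "(\<forall>j<sum_list cs. block_rotation p cs e j = block_rotation p cs f j) \<longleftrightarrow>
    (\<forall>i<length cs. int (cs ! i) dvd e i - f i)"
  using assms
proof (induction cs arbitrary: e f)
  case (Cons c cs)
  have c: "c > 0" using Cons.prems by auto
  have "(\<forall>j<sum_list (c # cs). block_rotation p (c # cs) e j = block_rotation p (c # cs) f j) \<longleftrightarrow>
      (\<forall>j<c. rotation p c (e 0) j = rotation p c (f 0) j) \<and>
      (\<forall>j<sum_list cs. block_rotation p cs (\<lambda>i. e (Suc i)) j = block_rotation p cs (\<lambda>i. f (Suc i)) j)"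
    (is "?L \<longleftrightarrow> ?R1 \<and> ?R2")
  proof
    assume L: ?L
    have ?R1
    proof (intro allI impI)
      fix j assume "j < c"
      then show "rotation p c (e 0) j = rotation p c (f 0) j" using L[rule_format, of j] by simp
    qed
    moreover have ?R2
    proof (intro allI impI)
      fix j assume "j < sum_list cs"
      then show "block_rotation p cs (\<lambda>i. e (Suc i)) j = block_rotation p cs (\<lambda>i. f (Suc i)) j"
        using L[rule_format, of "c + j"] by simp
    qed
    ultimately show "?R1 \<and> ?R2" by blast
  next
    assume R: "?R1 \<and> ?R2"
    show ?L
    proof (intro allI impI)
      fix j assume "j < sum_list (c # cs)"
      then show "block_rotation p (c # cs) e j = block_rotation p (c # cs) f j"
        using R by (cases "j < c") auto
    qed
  qed
  also have "?R1 \<longleftrightarrow> int c dvd e 0 - f 0"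
    using rotation_eq_iff[of _ c "e 0" "f 0"] c by blast
  also have "?R2 \<longleftrightarrow> (\<forall>i<length cs. int (cs ! i) dvd e (Suc i) - f (Suc i))"
    using Cons by simp
  finally show ?case by (simp add: All_less_Suc2)
qed simp

lemma block_index_less: "j < sum_list cs \<Longrightarrow> block_index cs j < length cs"
  by (induction cs arbitrary: j) auto

lemma block_index_image:
  assumes "0 \<notin> set cs" shows "block_index cs ` {..<sum_list cs} = {..<length cs}"
  using assms
proof (induction cs)
  case (Cons c cs)
  show ?case
  proof
    show "block_index (c # cs) ` {..<sum_list (c # cs)} \<subseteq> {..<length (c # cs)}"
      using block_index_less[of _ "c # cs"] by blast
    show "{..<length (c # cs)} \<subseteq> block_index (c # cs) ` {..<sum_list (c # cs)}"
    proof
      fix i assume i: "i \<in> {..<length (c # cs)}"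
      show "i \<in> block_index (c # cs) ` {..<sum_list (c # cs)}"
      proof (cases i)
        case 0
        then show ?thesis using Cons.prems by (intro image_eqI[of _ _ 0]) auto
      next
        case (Suc k)
        then have "k \<in> block_index cs ` {..<sum_list cs}" using i Cons by auto
        then obtain j where "k = block_index cs j" "j < sum_list cs" by blast
        then show ?thesis using Suc by (intro image_eqI[of _ _ "c + j"]) auto
      qed
    qed
  qed
qed simp

lemma block_rotation_orbit_iff:
  assumes "j < sum_list cs" "j' < sum_list cs"
  shows "(\<exists>e. block_rotation p cs e j = j') \<longleftrightarrow> block_index cs j = block_index cs j'"
  using assms
proof (induction cs arbitrary: j j')
  case (Cons c cs)
  show ?case
  proof
    assume "\<exists>e. block_rotation p (c # cs) e j = j'"
    then obtain e where e: "block_rotation p (c # cs) e j = j'" by blast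
    show "block_index (c # cs) j = block_index (c # cs) j'"
    proof (cases "j < c")
      case True
      then show ?thesis using e rotation_less[OF True, of "e 0"] by auto
    next
      case False
      then have j': "j' = c + block_rotation p cs (\<lambda>i. e (Suc i)) (j - c)" using e by simp
      then have "\<exists>e. block_rotation p cs e (j - c) = j' - c" by auto
      moreover have "j - c < sum_list cs" "j' - c < sum_list cs" using Cons.prems False j' by auto
      ultimately have "block_index cs (j - c) = block_index cs (j' - c)"
        using Cons.IH[of "j - c" "j' - c"] by blast
      then show ?thesis using False j' by simp
    qed
  next
    assume eq: "block_index (c # cs) j = block_index (c # cs) j'"
    show "\<exists>e. block_rotation p (c # cs) e j = j'"
    proof (cases "j < c")
      case True
      then have "j' < c" using eq by (auto split: if_splits)
      then obtain e where "rotation p c e j = j'" using rotation_transitive[OF True] by blast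
      then show ?thesis using True by (intro exI[of _ "\<lambda>_. e"]) simp
    next
      case False
      then have "\<not> j' < c" "block_index cs (j - c) = block_index cs (j' - c)"
        using eq by (auto split: if_splits)
      moreover have "j - c < sum_list cs" "j' - c < sum_list cs"
        using Cons.prems False \<open>\<not> j' < c\<close> by auto
      ultimately obtain e where "block_rotation p cs e (j - c) = j' - c"
        using Cons.IH[of "j - c" "j' - c"] by blast
      then show ?thesis using False \<open>\<not> j' < c\<close> by (intro exI[of _ "case_nat 0 e"]) simp
    qed
  qed
qed simp

end

primrec block_occs :: "(nat \<Rightarrow> 'a) \<Rightarrow> 'a \<Rightarrow> nat list \<Rightarrow> nat \<Rightarrow> nat list" where
  "block_occs x a [] i = []"
| "block_occs x a (c # cs) i = occ x a i c # block_occs x a cs (i + c)"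

text \<open>The lengths of the nonempty initial unions of blocks. Counting letters block by block is the same
  as counting them in the prefixes of these lengths.\<close>

primrec block_ends :: "nat list \<Rightarrow> nat set" where
  "block_ends [] = {}"
| "block_ends (c # cs) = insert c ((+) c ` block_ends cs)"

lemma finite_block_ends: "finite (block_ends cs)"
  by (induction cs) auto

lemma block_ends_positive: "0 \<notin> set cs \<Longrightarrow> 0 \<notin> block_ends cs"
  by (induction cs) auto

lemma card_block_ends: "0 \<notin> set cs \<Longrightarrow> card (block_ends cs) = length cs"
proof (induction cs)
  case (Cons c cs)
  then have "c \<notin> (+) c ` block_ends cs" using block_ends_positive[of cs] by auto
  then show ?case using Cons by (simp add: finite_block_ends card_image)
qed simp

lemma block_occs_eq_iff:
  "block_occs x a cs i = block_occs x a cs j \<longleftrightarrow> (\<forall>s\<in>block_ends cs. occ x a i s = occ x a j s)"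
proof (induction cs arbitrary: i j)
  case (Cons c cs)
  show ?case using Cons[of "i + c" "j + c"] by (auto simp: occ_add)
qed simp

text \<open>Cyclic arrangements \<open>p\<close> adapted to the word: in each length, factors with equally many letters
  \<open>a\<close> are rotations of each other along \<open>p\<close>.\<close>

locale sturmian_arrangements = sturmian_word x a b + cyclic_arrangements p
  for x :: "nat \<Rightarrow> 'a" and a b p +
  assumes rotate: "occ x a i m = occ x a j m \<Longrightarrow> \<exists>e. \<forall>k<m. x (j + p m (nat ((int k + e) mod int m))) = x (i + p m k)"
begin

lemma rotation_between_factors_iff:
  "(\<exists>e. \<forall>k<m. x (j + rotation p m e k) = x (i + k)) \<longleftrightarrow> occ x a i m = occ x a j m"
proof
  assume "occ x a i m = occ x a j m"
  then obtain e where e: "\<forall>k<m. x (j + p m (nat ((int k + e) mod int m))) = x (i + p m k)"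
    using rotate by blast
  have "x (j + rotation p m e k) = x (i + k)" if "k < m" for k
  proof -
    obtain l where l: "l < m" "k = p m l" using rank_cases[OF \<open>k < m\<close>] by blast
    show ?thesis unfolding l(2) rotation_rank[OF l(1)] using e l(1) by blast
  qed
  then show "\<exists>e. \<forall>k<m. x (j + rotation p m e k) = x (i + k)" by blast
next
  assume "\<exists>e. \<forall>k<m. x (j + rotation p m e k) = x (i + k)"
  then obtain e where e: "\<And>k. k < m \<Longrightarrow> x (j + rotation p m e k) = x (i + k)" by blast
  have "bij_betw (rotation p m e) {k. k < m \<and> x (i + k) = a} {k. k < m \<and> x (j + k) = a}"
  proof (rule bij_betw_byWitness[where f' = "rotation p m (- e)"])
    show "\<forall>k\<in>{k. k < m \<and> x (i + k) = a}. rotation p m (- e) (rotation p m e k) = k"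
      using rotation_add rotation_0 by simp
    show r: "\<forall>k\<in>{k. k < m \<and> x (j + k) = a}. rotation p m e (rotation p m (- e) k) = k"
      using rotation_add rotation_0 by simp
    show "rotation p m e ` {k. k < m \<and> x (i + k) = a} \<subseteq> {k. k < m \<and> x (j + k) = a}"
      using e rotation_less by auto
    show "rotation p m (- e) ` {k. k < m \<and> x (j + k) = a} \<subseteq> {k. k < m \<and> x (i + k) = a}"
    proof (rule image_subsetI)
      fix k assume k: "k \<in> {k. k < m \<and> x (j + k) = a}"
      then have "rotation p m (- e) k < m" using rotation_less by simp
      then show "rotation p m (- e) k \<in> {k. k < m \<and> x (i + k) = a}"
        using e[of "rotation p m (- e) k"] r k by simp
    qed
  qed
  then show "occ x a i m = occ x a j m" unfolding occ_eq_card by (rule bij_betw_same_card)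
qed

text \<open>The blocks of a factor are themselves factors and are rotated independently, so the counts in the
  single blocks form a complete set of invariants.\<close>

lemma block_rotation_between_factors_iff:
  "(\<exists>e. \<forall>k<sum_list cs. x (j + block_rotation p cs e k) = x (i + k)) \<longleftrightarrow>
    block_occs x a cs i = block_occs x a cs j"
proof (induction cs arbitrary: i j)
  case (Cons c cs)
  have split: "(\<forall>k<sum_list (c # cs). x (j + block_rotation p (c # cs) e k) = x (i + k)) \<longleftrightarrow>
      (\<forall>k<c. x (j + rotation p c (e 0) k) = x (i + k)) \<and>
      (\<forall>k<sum_list cs. x (j + c + block_rotation p cs (\<lambda>i. e (Suc i)) k) = x (i + c + k))"
    (is "?L e \<longleftrightarrow> ?R1 (e 0) \<and> ?R2 (\<lambda>i. e (Suc i))") for e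
  proof
    assume L: "?L e"
    have "?R1 (e 0)"
    proof (intro allI impI)
      fix k assume "k < c"
      then show "x (j + rotation p c (e 0) k) = x (i + k)" using L[rule_format, of k] by simp
    qed
    moreover have "?R2 (\<lambda>i. e (Suc i))"
    proof (intro allI impI)
      fix k assume "k < sum_list cs"
      then show "x (j + c + block_rotation p cs (\<lambda>i. e (Suc i)) k) = x (i + c + k)"
        using L[rule_format, of "c + k"] by (simp add: add.assoc)
    qed
    ultimately show "?R1 (e 0) \<and> ?R2 (\<lambda>i. e (Suc i))" by blast
  next
    assume R: "?R1 (e 0) \<and> ?R2 (\<lambda>i. e (Suc i))"
    show "?L e"
    proof (intro allI impI)
      fix k assume k: "k < sum_list (c # cs)"
      show "x (j + block_rotation p (c # cs) e k) = x (i + k)"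
      proof (cases "k < c")
        case True
        then show ?thesis using R by simp
      next
        case False
        then show ?thesis using conjunct2[OF R, rule_format, of "k - c"] k by (simp add: add.assoc)
      qed
    qed
  qed
  have "(\<exists>e. ?R1 (e 0) \<and> ?R2 (\<lambda>i. e (Suc i))) \<longleftrightarrow> (\<exists>d. ?R1 d) \<and> (\<exists>e. ?R2 e)"
  proof
    assume "(\<exists>d. ?R1 d) \<and> (\<exists>e. ?R2 e)"
    then obtain d e where "?R1 d" "?R2 e" by blast
    then show "\<exists>e. ?R1 (e 0) \<and> ?R2 (\<lambda>i. e (Suc i))" by (intro exI[of _ "case_nat d e"]) simp
  qed blast
  then show ?case
    unfolding split using rotation_between_factors_iff[where i = i and j = j and m = c] Cons.IH[of "j + c" "i + c"] by simp
qed simp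

end

section \<open>Groups of block permutations\<close>

text \<open>Two images of one parameter set with the same coincidences are isomorphic; the operation \<open>comb\<close> on
  parameters links the two multiplications.\<close>

lemma is_iso_if_same_kernel:
  assumes u: "range u = carrier G" and v: "range v = carrier H"
    and ker: "\<And>e f. u e = u f \<longleftrightarrow> v e = v f"
    and u_add: "\<And>e f. u (comb e f) = u e \<otimes>\<^bsub>G\<^esub> u f" and v_add: "\<And>e f. v (comb e f) = v e \<otimes>\<^bsub>H\<^esub> v f"
  shows "G \<cong> H"
proof -
  define \<phi> where "\<phi> h = v (SOME e. u e = h)" for h
  have \<phi>: "\<phi> (u e) = v e" for e
  proof -
    have "u (SOME f. u f = u e) = u e" by (rule someI[of _ e]) simp
    then show ?thesis using ker unfolding \<phi>_def by blast
  qed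
  have "\<phi> \<in> hom G H"
  proof (rule homI)
    fix g h assume "g \<in> carrier G" "h \<in> carrier G"
    then obtain e f where gh: "g = u e" "h = u f" using u by blast
    show "\<phi> g \<in> carrier H" using \<phi> gh v by blast
    show "\<phi> (g \<otimes>\<^bsub>G\<^esub> h) = \<phi> g \<otimes>\<^bsub>H\<^esub> \<phi> h" by (simp add: gh \<phi> v_add flip: u_add)
  qed
  moreover have "bij_betw \<phi> (carrier G) (carrier H)"
    unfolding bij_betw_def
  proof
    show "inj_on \<phi> (carrier G)" by (auto simp: inj_on_def \<phi> ker simp flip: u)
    show "\<phi> ` carrier G = carrier H" by (simp add: \<phi> image_image flip: u v)
  qed
  ultimately show ?thesis by (auto simp: is_iso_def iso_def)
qed

lemma card_image_eq_if_same_kernel: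
  assumes "\<And>s t. s \<in> A \<Longrightarrow> t \<in> A \<Longrightarrow> f s = f t \<longleftrightarrow> g s = g t"
  shows "card (f ` A) = card (g ` A)"
proof -
  define h where "h y = g (SOME s. s \<in> A \<and> f s = y)" for y
  have h: "h (f s) = g s" if "s \<in> A" for s
  proof -
    have "(SOME t. t \<in> A \<and> f t = f s) \<in> A \<and> f (SOME t. t \<in> A \<and> f t = f s) = f s"
      by (rule someI[of _ s]) (simp add: that)
    then show ?thesis using assms that unfolding h_def by blast
  qed
  have "bij_betw h (f ` A) (g ` A)"
    unfolding bij_betw_def using assms by (auto simp: inj_on_def h image_iff)
  then show ?thesis by (rule bij_betw_same_card)
qed

text \<open>Block rotations act on \<open>0, \<dots>, n - 1\<close>, members of the symmetric group on \<open>1, \<dots>, n\<close>; the point \<open>0\<close>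
  has to be fixed.\<close>

definition block_perm :: "(nat \<Rightarrow> nat \<Rightarrow> nat) \<Rightarrow> nat list \<Rightarrow> (nat \<Rightarrow> int) \<Rightarrow> nat \<Rightarrow> nat" where
  "block_perm p cs e j = (case j of 0 \<Rightarrow> 0 | Suc k \<Rightarrow> Suc (block_rotation p cs e k))"

context cyclic_arrangements begin

lemma block_perm_simps [simp]:
  "block_perm p cs e 0 = 0" "block_perm p cs e (Suc k) = Suc (block_rotation p cs e k)"
  by (simp_all add: block_perm_def)

lemma block_perm_comp: "block_perm p cs e \<circ> block_perm p cs f = block_perm p cs (\<lambda>i. e i + f i)"
proof
  fix j show "(block_perm p cs e \<circ> block_perm p cs f) j = block_perm p cs (\<lambda>i. e i + f i) j"
    by (cases j) (simp_all add: block_rotation_add)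
qed

lemma block_perm_0: "block_perm p cs (\<lambda>_. 0) = id"
proof
  fix j show "block_perm p cs (\<lambda>_. 0) j = id j"
    by (cases j) (simp_all add: block_rotation_0)
qed

lemma block_perm_inverse:
  "block_perm p cs (\<lambda>i. - e i) \<circ> block_perm p cs e = id"
  "block_perm p cs e \<circ> block_perm p cs (\<lambda>i. - e i) = id"
  by (simp_all add: block_perm_comp block_perm_0)

lemma inv_block_perm: "inv' (block_perm p cs e) = block_perm p cs (\<lambda>i. - e i)"
  using inv_unique_comp[OF block_perm_inverse(2) block_perm_inverse(1)] .

lemma block_perm_permutes: "block_perm p cs e permutes {1..sum_list cs}"
proof -
  have "bij (block_perm p cs e)"
    using o_bij[OF block_perm_inverse(1) block_perm_inverse(2)] .
  moreover have "block_perm p cs e j = j" if "j \<notin> {1..sum_list cs}" for j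
    using that by (cases j) (auto simp: block_rotation_ge)
  ultimately show ?thesis by (simp add: permutes_def bij_iff)
qed

lemma block_perm_eq_iff:
  assumes "0 \<notin> set cs"
  shows "block_perm p cs e = block_perm p cs f \<longleftrightarrow> (\<forall>i<length cs. int (cs ! i) dvd e i - f i)"
proof -
  have "block_perm p cs e = block_perm p cs f \<longleftrightarrow> (\<forall>k. block_rotation p cs e k = block_rotation p cs f k)"
  proof
    assume "block_perm p cs e = block_perm p cs f"
    then have "block_perm p cs e (Suc k) = block_perm p cs f (Suc k)" for k by simp
    then show "\<forall>k. block_rotation p cs e k = block_rotation p cs f k" by simp
  next
    assume *: "\<forall>k. block_rotation p cs e k = block_rotation p cs f k"
    show "block_perm p cs e = block_perm p cs f"
      using * by (auto simp: block_perm_def fun_eq_iff split: nat.split)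
  qed
  also have "\<dots> \<longleftrightarrow> (\<forall>k<sum_list cs. block_rotation p cs e k = block_rotation p cs f k)"
    using block_rotation_ge[of cs] by (metis linorder_not_le)
  finally show ?thesis using block_rotation_eq_iff[OF assms] by simp
qed

lemma block_perms_subgroup: "subgroup (range (block_perm p cs)) (sym_group (sum_list cs))"
proof (rule group.subgroupI[OF sym_group_is_group])
  show "range (block_perm p cs) \<subseteq> carrier (sym_group (sum_list cs))"
    using block_perm_permutes by (auto simp: sym_group_carrier)
  show "range (block_perm p cs) \<noteq> {}" by blast
next
  fix g assume "g \<in> range (block_perm p cs)"
  then obtain e where g: "g = block_perm p cs e" by blast
  then have "g \<in> carrier (sym_group (sum_list cs))"
    using block_perm_permutes by (simp add: sym_group_carrier)
  then show "inv\<^bsub>sym_group (sum_list cs)\<^esub> g \<in> range (block_perm p cs)"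
    using g by (simp add: inv_block_perm)
next
  fix g h assume "g \<in> range (block_perm p cs)" "h \<in> range (block_perm p cs)"
  then show "g \<otimes>\<^bsub>sym_group (sum_list cs)\<^esub> h \<in> range (block_perm p cs)"
    by (auto simp: sym_group_mult block_perm_comp)
qed

lemma block_perms_comm_group: "comm_group (sym_subgroup (sum_list cs) (range (block_perm p cs)))"
proof (rule group.group_comm_groupI)
  show "group (sym_subgroup (sum_list cs) (range (block_perm p cs)))"
    using subgroup.subgroup_is_group[OF block_perms_subgroup sym_group_is_group] .
  show "g \<otimes>\<^bsub>sym_subgroup (sum_list cs) (range (block_perm p cs))\<^esub> h =
      h \<otimes>\<^bsub>sym_subgroup (sum_list cs) (range (block_perm p cs))\<^esub> g"
    if "g \<in> carrier (sym_subgroup (sum_list cs) (range (block_perm p cs)))"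
      "h \<in> carrier (sym_subgroup (sum_list cs) (range (block_perm p cs)))" for g h
    using that by (auto simp: sym_group_mult block_perm_comp add.commute)
qed

lemma num_orbits_block_perms:
  assumes "0 \<notin> set cs"
  shows "num_orbits (sum_list cs) (range (block_perm p cs)) = length cs"
proof -
  let ?n = "sum_list cs"
  let ?G = "sym_subgroup ?n (range (block_perm p cs))"
  let ?O = "\<lambda>k. orbit ?G (\<lambda>g i. g i) (Suc k)"
  have O: "?O k = Suc ` {l. l < ?n \<and> block_index cs k = block_index cs l}" if k: "k < ?n" for k
  proof -
    have "?O k = (\<lambda>g. g (Suc k)) ` range (block_perm p cs)" by (auto simp: orbit_def)
    also have "\<dots> = Suc ` (\<lambda>e. block_rotation p cs e k) ` UNIV" by (simp add: image_image)
    also have "(\<lambda>e. block_rotation p cs e k) ` UNIV = {l. l < ?n \<and> block_index cs k = block_index cs l}"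
      using block_rotation_orbit_iff[OF k] block_rotation_less[OF k] by blast
    finally show ?thesis .
  qed
  have "{1..?n} = Suc ` {..<?n}" by (simp add: lessThan_atLeast0 image_Suc_atLeastLessThan atLeastLessThanSuc_atLeastAtMost)
  then have "orbits ?G {1..?n} (\<lambda>g i. g i) = ?O ` {..<?n}"
    unfolding orbits_def by auto
  then have "num_orbits ?n (range (block_perm p cs)) = card (?O ` {..<?n})"
    by (simp add: num_orbits_def)
  also have "\<dots> = card (block_index cs ` {..<?n})"
  proof (rule card_image_eq_if_same_kernel)
    fix k l assume kl: "k \<in> {..<?n}" "l \<in> {..<?n}"
    then have "?O k = ?O l \<longleftrightarrow>
        {r. r < ?n \<and> block_index cs k = block_index cs r} = {r. r < ?n \<and> block_index cs l = block_index cs r}"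
      by (simp add: O inj_image_eq_iff)
    also have "\<dots> \<longleftrightarrow> block_index cs k = block_index cs l"
      using kl by auto
    finally show "?O k = ?O l \<longleftrightarrow> block_index cs k = block_index cs l" .
  qed
  also have "\<dots> = length cs" using block_index_image[OF assms] by simp
  finally show ?thesis .
qed

end

context sturmian_arrangements begin

text \<open>The action on words moves letters by the inverse permutation; as \<open>e\<close> runs through all exponents,
  so does \<open>- e\<close>, and the direction does not matter.\<close>

lemma fact_rel_block_perms_iff:
  "(map x [i..<i + sum_list cs], map x [j..<j + sum_list cs]) \<in> fact_rel (range (block_perm p cs)) x (sum_list cs)
    \<longleftrightarrow> block_occs x a cs i = block_occs x a cs j"
proof -
  let ?n = "sum_list cs"
  let ?u = "\<lambda>i. map x [i..<i + ?n]"
  have act: "word_act (block_perm p cs e) (?u i) = ?u j \<longleftrightarrow>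
      (\<forall>k<?n. x (i + block_rotation p cs (\<lambda>l. - e l) k) = x (j + k))" for e
    unfolding list_eq_iff_nth_eq word_act_def inv_block_perm
    by (simp add: block_rotation_less del: upt_Suc)
  have "(?u i, ?u j) \<in> fact_rel (range (block_perm p cs)) x ?n \<longleftrightarrow>
      (\<exists>e. word_act (block_perm p cs e) (?u i) = ?u j)"
    by (auto simp: fact_rel_def Fact_def)
  also have "\<dots> \<longleftrightarrow> (\<exists>e. \<forall>k<?n. x (i + block_rotation p cs e k) = x (j + k))"
  proof
    assume "\<exists>e. \<forall>k<?n. x (i + block_rotation p cs e k) = x (j + k)"
    then obtain e where "\<forall>k<?n. x (i + block_rotation p cs e k) = x (j + k)" by blast
    then show "\<exists>e. word_act (block_perm p cs e) (?u i) = ?u j"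
      unfolding act by (intro exI[of _ "\<lambda>l. - e l"]) simp
  qed (auto simp: act)
  also have "\<dots> \<longleftrightarrow> block_occs x a cs j = block_occs x a cs i"
    by (rule block_rotation_between_factors_iff)
  finally show ?thesis by auto
qed

text \<open>A class is determined by the lengths in \<open>block_ends cs\<close> at which the prefix of the factor is
  heavy, so classes correspond to the members of a separating chain of subsets of \<open>block_ends cs\<close>, a
  set with one element for each block.\<close>

lemma card_factor_classes:
  assumes "0 \<notin> set cs"
  shows "card (Fact x (sum_list cs) // fact_rel (range (block_perm p cs)) x (sum_list cs)) = Suc (length cs)"
proof -
  let ?n = "sum_list cs"
  let ?u = "\<lambda>i. map x [i..<i + ?n]"
  let ?R = "fact_rel (range (block_perm p cs)) x ?n"
  let ?T = "\<lambda>i. {s \<in> block_ends cs. low x a s < occ x a i s}"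
  have cls: "?R `` {?u i} = ?u ` {j. block_occs x a cs i = block_occs x a cs j}" for i
    using fact_rel_block_perms_iff[of i cs] by (auto simp: fact_rel_def Fact_def image_iff)
  have same: "?R `` {?u i} = ?R `` {?u j} \<longleftrightarrow> ?T i = ?T j" for i j
  proof -
    have "?R `` {?u i} = ?R `` {?u j} \<longleftrightarrow> block_occs x a cs i = block_occs x a cs j"
    proof
      assume eq: "?R `` {?u i} = ?R `` {?u j}"
      have "?u j \<in> ?R `` {?u j}" unfolding cls by blast
      then have "(?u i, ?u j) \<in> ?R" using eq by blast
      then show "block_occs x a cs i = block_occs x a cs j" using fact_rel_block_perms_iff by blast
    qed (simp add: cls)
    also have "\<dots> \<longleftrightarrow> (\<forall>s\<in>block_ends cs. occ x a i s = occ x a j s)" by (rule block_occs_eq_iff)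
    also have "\<dots> \<longleftrightarrow> (\<forall>s\<in>block_ends cs. low x a s < occ x a i s \<longleftrightarrow> low x a s < occ x a j s)"
    proof (intro ball_cong refl)
      fix s
      show "occ x a i s = occ x a j s \<longleftrightarrow> (low x a s < occ x a i s \<longleftrightarrow> low x a s < occ x a j s)"
        using low_le[of s i] low_le[of s j] occ_le_Suc_low[of i s] occ_le_Suc_low[of j s] by linarith
    qed
    also have "\<dots> \<longleftrightarrow> ?T i = ?T j" by blast
    finally show ?thesis .
  qed
  have "Fact x ?n = range ?u" by (auto simp: Fact_def)
  then have "Fact x ?n // ?R = range (\<lambda>i. ?R `` {?u i})" by (auto simp: quotient_def)
  then have "card (Fact x ?n // ?R) = card (range ?T)"
    using card_image_eq_if_same_kernel[of UNIV "\<lambda>i. ?R `` {?u i}" ?T] same by simp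
  also have "\<dots> = Suc (card (block_ends cs))"
    using card_occurrence_sets[OF finite_block_ends block_ends_positive[OF assms]] .
  finally show ?thesis using card_block_ends[OF assms] by simp
qed

end

section \<open>Realizing abelian permutation groups\<close>

text \<open>Padding with identity elements brings the sum of the orders up to exactly \<open>n\<close>, so that the orders
  can serve as lengths of blocks filling \<open>{1..n}\<close>; the padding becomes fixed points.\<close>

lemma abelian_permutation_group_cyclic_basis:
  assumes H: "subgroup H (sym_group n)" and comm: "comm_group (sym_subgroup n H)"
  obtains gs where "comm_group.cyclic_basis (sym_subgroup n H) gs H"
    "sum_list (map (group.ord (sym_subgroup n H)) gs) = n" "0 \<notin> set (map (group.ord (sym_subgroup n H)) gs)"
proof -
  let ?G = "sym_subgroup n H"
  interpret G: comm_group ?G by (rule comm)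
  have Hp: "h permutes {1..n}" if "h \<in> H" for h
    using subgroup.subset[OF H] that by (auto simp: sym_group_carrier)
  have "H \<subseteq> {h. h permutes {1..n}}" using Hp by blast
  then have fin: "finite (carrier ?G)" using finite_permutations[of "{1..n}"] finite_subset by auto
  have one: "\<one>\<^bsub>?G\<^esub> = id" by (simp add: sym_group_one)
  have K: "subgroup H ?G" using G.subgroup_self by simp
  have "\<exists>gs. G.cyclic_basis gs H \<and> sum_list (map G.ord gs) \<le> card {1..n}"
  proof (rule G.faithful_action_cyclic_basis[OF fin _ _ K, where act = "\<lambda>g. g"])
    show "\<one>\<^bsub>?G\<^esub> i = i" for i by (simp add: one)
    show "(g \<otimes>\<^bsub>?G\<^esub> h) i = g (h i)" for g h i by (simp add: sym_group_mult)
    show "h i \<in> {1..n}" if "h \<in> H" "i \<in> {1..n}" for h i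
      using permutes_in_image[OF Hp[OF that(1)]] that(2) by blast
    show "h = \<one>\<^bsub>?G\<^esub>" if h: "h \<in> H" "\<And>i. i \<in> {1..n} \<Longrightarrow> h i = i" for h
      unfolding one using permutes_not_in[OF Hp[OF h(1)]] h(2) by (metis eq_id_iff)
  qed simp
  then obtain gs where gs: "G.cyclic_basis gs H" "sum_list (map G.ord gs) = n"
    using G.cyclic_basis_pad[OF _ K] by auto
  moreover have "0 \<notin> set (map G.ord gs)"
  proof
    assume "0 \<in> set (map G.ord gs)"
    then obtain g where "g \<in> set gs" "G.ord g = 0" by auto
    moreover have "set gs \<subseteq> H" using gs(1) by (simp add: G.cyclic_basis_def)
    ultimately show False using G.ord_ge_1[OF fin, of g] by auto
  qed
  ultimately show ?thesis using that by blast
qed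

text \<open>Take blocks whose lengths are the orders in a cyclic basis of \<open>H\<close>. Products of powers of the basis
  and block rotations are parametrized by the same exponents, and both depend exactly on the residues
  of the exponents modulo these orders.\<close>

lemma (in sturmian_arrangements) abelian_complexity_realized:
  assumes H: "subgroup H (sym_group n)" and comm: "comm_group (sym_subgroup n H)"
  shows "\<exists>H'. subgroup H' (sym_group n) \<and> comm_group (sym_subgroup n H') \<and>
    sym_subgroup n H' \<cong> sym_subgroup n H \<and>
    card (Fact x n // fact_rel H' x n) = num_orbits n H' + 1"
proof -
  let ?G = "sym_subgroup n H"
  interpret G: comm_group ?G by (rule comm)
  obtain gs where gs: "G.cyclic_basis gs H" and sum: "sum_list (map G.ord gs) = n"
    and pos: "0 \<notin> set (map G.ord gs)"
    using abelian_permutation_group_cyclic_basis[OF H comm] by blast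
  define cs where "cs = map G.ord gs"
  have n: "sum_list cs = n" and cs0: "0 \<notin> set cs" using sum pos by (simp_all add: cs_def)
  have gsH: "set gs \<subseteq> carrier ?G" and ran: "range (power_product ?G gs) = carrier ?G"
    using gs by (simp_all add: G.cyclic_basis_def)
  have "sym_subgroup n (range (block_perm p cs)) \<cong> ?G"
  proof (rule is_iso_if_same_kernel[where u = "block_perm p cs" and v = "power_product ?G gs"
        and comb = "\<lambda>e f i. e i + f i"])
    show "block_perm p cs e = block_perm p cs f \<longleftrightarrow> power_product ?G gs e = power_product ?G gs f" for e f
      using block_perm_eq_iff[OF cs0, of e f] G.power_product_eq_iff[OF gs, of e f] by (simp add: cs_def)
    show "power_product ?G gs (\<lambda>i. e i + f i) = power_product ?G gs e \<otimes>\<^bsub>?G\<^esub> power_product ?G gs f" for e f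
      by (rule G.power_product_add[OF gsH])
  qed (simp_all add: ran[simplified] sym_group_mult block_perm_comp)
  moreover have "card (Fact x n // fact_rel (range (block_perm p cs)) x n) =
      num_orbits n (range (block_perm p cs)) + 1"
    using card_factor_classes[OF cs0] num_orbits_block_perms[OF cs0] by (simp add: n)
  ultimately show ?thesis
    using block_perms_subgroup[of cs] block_perms_comm_group[of cs] unfolding n by blast
qed

lemma sturmian_imp_arrangements:
  assumes "sturmian x"
  obtains a b p where "sturmian_arrangements x a b p"
proof -
  have "card (range x) = 2" using assms by (simp add: sturmian_def binary_word_def)
  then obtain a b where ab: "range x = {a, b}" "a \<noteq> b" by (auto simp: card_2_iff)
  interpret sturmian_word x a b using assms ab by unfold_locales
  have "\<forall>m. \<exists>p. bij_betw p {..<m} {..<m} \<and>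
    (\<forall>i j. occ x a i m = occ x a j m \<longrightarrow>
      (\<exists>e. \<forall>k<m. x (j + p (nat ((int k + e) mod int m))) = x (i + p k)))"
    by (intro allI equal_occ_factors_rotated)
  from choice[OF this] obtain p where p: "\<forall>m. bij_betw (p m) {..<m} {..<m} \<and>
    (\<forall>i j. occ x a i m = occ x a j m \<longrightarrow>
      (\<exists>e. \<forall>k<m. x (j + p m (nat ((int k + e) mod int m))) = x (i + p m k)))" ..
  have "sturmian_arrangements x a b p"
    using p by unfold_locales blast+
  then show ?thesis using that by blast
qed

theorem theorem2:
  fixes x :: "nat \<Rightarrow> 'a"
    and \<omega> :: "nat \<Rightarrow> (nat \<Rightarrow> nat) set"
  assumes "sturmian x"
    and "\<And>n. n \<ge> 1 \<Longrightarrow> subgroup (\<omega> n) (sym_group n)"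
    and "\<And>n. n \<ge> 1 \<Longrightarrow> comm_group (sym_subgroup n (\<omega> n))"
  shows "\<exists>\<omega>' :: nat \<Rightarrow> (nat \<Rightarrow> nat) set.
    (\<forall>n\<ge>1. subgroup (\<omega>' n) (sym_group n) \<and>
           comm_group (sym_subgroup n (\<omega>' n)) \<and>
           sym_subgroup n (\<omega>' n) \<cong> sym_subgroup n (\<omega> n)) \<and>
    (\<forall>n\<ge>1. group_complexity \<omega>' x n = num_orbits n (\<omega>' n) + 1)"
proof -
  obtain a b p where "sturmian_arrangements x a b p"
    using sturmian_imp_arrangements[OF assms(1)] by blast
  then interpret sturmian_arrangements x a b p .
  have "\<forall>n. \<exists>H'. n \<ge> 1 \<longrightarrow> subgroup H' (sym_group n) \<and> comm_group (sym_subgroup n H') \<and>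
      sym_subgroup n H' \<cong> sym_subgroup n (\<omega> n) \<and>
      card (Fact x n // fact_rel H' x n) = num_orbits n H' + 1"
    using abelian_complexity_realized assms(2,3) by blast
  from choice[OF this] obtain \<omega>' where "\<forall>n. n \<ge> 1 \<longrightarrow> subgroup (\<omega>' n) (sym_group n) \<and> comm_group (sym_subgroup n (\<omega>' n)) \<and>
      sym_subgroup n (\<omega>' n) \<cong> sym_subgroup n (\<omega> n) \<and>
      card (Fact x n // fact_rel (\<omega>' n) x n) = num_orbits n (\<omega>' n) + 1" ..
  then show ?thesis unfolding group_complexity_def by (intro exI[of _ \<omega>']) blast
qed

end
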